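(* For every prime $p\equiv1\pmod 3$ and all $\tau\in\mathbb H$ (with $q=e^{2\pi i\tau}$), $$\sum_{j=0}^2 e_j=\frac{1-p}{24},\qquad G_0(\tau)G_1(\tau)G_2(\tau)=\frac{\eta(p\tau)}{\eta(\tau)},\qquad G_j\left(-\frac1{p\tau}\right)=\frac{q^{-m/12}}{2^m s_jT_j(\tau)}\quad(j=0,1,2).$$ In particular $$(G_0G_1G_2)\left(-\frac1{p\tau}\right)=\frac{1}{\sqrt p\,(G_0G_1G_2)(\tau)}.$$
   Context: $\mathbb H$ is the upper half-plane, $q=e^{2\pi i\tau}$, and fractional powers mean $q^r=e^{2\pi i r\tau}$. Let $p\equiv1\pmod3$ be prime, $m=(p-1)/6$, and let $C_0,C_1,C_2$ be the three cosets of the subgroup of nonzero cubic residues in $(\mathbb Z/p\mathbb Z)^\times$. Put $B_2(x)=x^2-x+\frac16$, $\zeta_p=e^{2\pi i/p}$, and $$C_j^+=\{a\in\mathbb Z: 1\le a<p/2,\ a\bmod p\in C_j\},\qquad e_j=\frac p2\sum_{a\in C_j^+}B_2(a/p),$$ $$G_j(\tau)=q^{-e_j}\prod_{\substack{n>0\\ n\bmod p\in C_j}}(1-q^n)^{-1},\qquad s_j=\prod_{a\in C_j^+}\sin(\pi a/p),\qquad T_j(\tau)=\prod_{n\ge1}\prod_{a\in C_j}(1-\zeta_p^aq^n).$$ $\eta(\tau)=q^{1/24}\prod_{n\ge1}(1-q^n)$ is the Dedekind eta function. *)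

theory Defs
  imports "HOL-Analysis.Analysis" "HOL-Number_Theory.Number_Theory"
begin

text \<open>
  A coset of the cubic residues is represented, as in \<open>residue_ring\<close>, by the set of its
  representatives in \<open>{1..p-1}\<close>. The quantities attached to a coset are defined for an
  arbitrary set \<open>D\<close> of such representatives.
\<close>

definition nonzero_cubic_residues :: "nat \<Rightarrow> int set" where
  "nonzero_cubic_residues p = {x \<in> {1..<int p}. \<exists>y. [y ^ 3 = x] (mod int p)}"

definition cubic_cosets :: "nat \<Rightarrow> int set set" where
  "cubic_cosets p = rcosets\<^bsub>units_of (residue_ring (int p))\<^esub> (nonzero_cubic_residues p)"

definition B2 :: "real \<Rightarrow> real" where
  "B2 x = x\<^sup>2 - x + 1 / 6"

definition qpow :: "complex \<Rightarrow> real \<Rightarrow> complex" where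
  "qpow \<tau> r = exp (2 * of_real pi * \<i> * of_real r * \<tau>)"

abbreviation nome :: "complex \<Rightarrow> complex" where
  "nome \<tau> \<equiv> exp (2 * of_real pi * \<i> * \<tau>)"

definition half_reps :: "nat \<Rightarrow> int set \<Rightarrow> int set" where
  "half_reps p D = {a. 1 \<le> a \<and> real_of_int a < real p / 2 \<and> a mod int p \<in> D}"

definition e_exp :: "nat \<Rightarrow> int set \<Rightarrow> real" where
  "e_exp p D = real p / 2 * (\<Sum>a\<in>half_reps p D. B2 (real_of_int a / real p))"

text \<open>
  The library's infinite product starts at index \<open>0\<close>, so below the factor belonging to \<open>n\<close> is
  the one written with \<open>Suc n\<close> in the usual products over positive integers.
\<close>

definition G :: "nat \<Rightarrow> int set \<Rightarrow> complex \<Rightarrow> complex" where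
  "G p D \<tau> = qpow \<tau> (- e_exp p D) *
     (\<Prod>n. if int (Suc n) mod int p \<in> D then inverse (1 - nome \<tau> ^ Suc n) else 1)"

definition s_prod :: "nat \<Rightarrow> int set \<Rightarrow> real" where
  "s_prod p D = (\<Prod>a\<in>half_reps p D. sin (pi * real_of_int a / real p))"

definition zeta :: "nat \<Rightarrow> complex" where
  "zeta p = exp (2 * of_real pi * \<i> / of_nat p)"

definition T_prod :: "nat \<Rightarrow> int set \<Rightarrow> complex \<Rightarrow> complex" where
  "T_prod p D \<tau> = (\<Prod>n. \<Prod>a\<in>D. 1 - zeta p powi a * nome \<tau> ^ Suc n)"

definition dedekind_eta :: "complex \<Rightarrow> complex" where
  "dedekind_eta \<tau> = qpow \<tau> (1 / 24) * (\<Prod>n. 1 - nome \<tau> ^ Suc n)"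

end

theory Submission
  imports Defs "HOL-Complex_Analysis.Complex_Analysis"
begin

text \<open>
  Everything rests on one analytic fact, the behaviour under \<open>T \<mapsto> -1/T\<close> of the quotient of the
  odd Jacobi theta function by the Dedekind eta function,
  \<open>\<theta>\<^sub>1(z, T) / \<eta>(T) = 2 sin (\<pi>z) q^(1/12) \<Prod> (1 - e^(2\<pi>iz) q^n) (1 - e^(-2\<pi>iz) q^n)\<close>, where
  \<open>q = e^(2\<pi>iT)\<close> and \<open>n\<close> runs over the positive integers.
  At \<open>z = xT\<close> with \<open>0 < x < 1\<close> this is, up to an exponential whose exponent is governed by
  \<open>B2 x\<close>, the product of the \<open>1 - q^n\<close> over the \<open>n > 0\<close> in \<open>x + \<int>\<close> and in \<open>-x + \<int>\<close>; at \<open>z = x\<close> it is \<open>2 sin (\<pi> x)\<close>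
  times the product of the \<open>1 - e^(\<plusminus>2\<pi>ix) q^n\<close>. The inversion formula exchanges the two shapes
  (\<open>siegel_inversion\<close>). A cubic coset is closed under negation because \<open>-1 = (-1)^3\<close> is a cube, so
  the product in \<open>G\<close> groups into pairs \<open>a\<close>, \<open>p - a\<close>; multiplying the formula for \<open>x = a/p\<close> over the
  representatives \<open>a < p/2\<close> gives the transformation of \<open>G\<close> (\<open>G_inversion\<close>), for every set of
  residues closed under negation.

  The inversion formula itself (\<open>theta_quot_inversion\<close>) is proved by Liouville's theorem. Both
  sides are entire in \<open>z\<close>, have the same multipliers for \<open>z \<mapsto> z + 1\<close> and \<open>z \<mapsto> z + T\<close>, and the
  one in the denominator has only simple zeros, at the lattice points, where the other vanishes
  too; so the quotient extends to an entire doubly periodic function and is a constant \<open>c T\<close>.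
  Multiplying over the three nonzero points of order two, where the infinite products collapse by
  an identity of Euler, yields \<open>c T ^ 3 = \<i>\<close>. Hence \<open>c\<close> is a continuous function on the upper
  half-plane with finitely many values, thus constant, and the derivative at \<open>z = 0\<close> for the
  fixed point \<open>T = \<i>\<close> shows that \<open>c = - \<i>\<close>.

  The statements on the product of the three \<open>G\<close>'s concern the set of all nonzero residues, since
  \<open>G\<close> is multiplicative and \<open>e_exp\<close> additive over disjoint sets. For this set the sum of the
  values of \<open>B2\<close> is elementary, the infinite product is the quotient of the Euler products
  belonging to \<open>\<eta>(p\<tau>)\<close> and \<open>\<eta>(\<tau>)\<close>, and its transform is \<open>G_inversion\<close> once more, where \<open>T_prod\<close>
  is evaluated by the factorisation of \<open>1 - x^p\<close> and \<open>s_prod\<close> by the value of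
  \<open>\<Prod> 2 sin (\<pi> k/p)\<close>.
\<close>

section \<open>The exponential with period one\<close>

text \<open>
  The same function as \<open>nome\<close>, as a constant of its own: the simplifier leaves it folded, so
  that identities between exponentials reduce to identities between their arguments.
\<close>

definition e2pi :: "complex \<Rightarrow> complex" where "e2pi z = exp (2 * of_real pi * \<i> * z)"

lemma e2pi_add: "e2pi (x + y) = e2pi x * e2pi y" by (simp add: e2pi_def ring_distribs exp_add)

lemma e2pi_0 [simp]: "e2pi 0 = 1" by (simp add: e2pi_def)

lemma e2pi_minus: "e2pi (- x) = inverse (e2pi x)" by (simp add: e2pi_def exp_minus)

lemma e2pi_diff: "e2pi (x - y) = e2pi x / e2pi y" by (simp add: e2pi_def ring_distribs exp_diff)

lemma e2pi_nonzero [simp]: "e2pi x \<noteq> 0" by (simp add: e2pi_def)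

lemma e2pi_eq_1_iff: "e2pi z = 1 \<longleftrightarrow> z \<in> \<int>"
proof
  assume "e2pi z = 1"
  then obtain n :: int where "Re (2 * of_real pi * \<i> * z) = 0"
      "Im (2 * of_real pi * \<i> * z) = of_int (2 * n) * pi"
    unfolding e2pi_def exp_eq_1 by auto
  then have "z = of_int n" by (auto simp: complex_eq_iff)
  then show "z \<in> \<int>" by simp
next
  assume "z \<in> \<int>"
  then obtain n where "z = of_int n" by (elim Ints_cases)
  then show "e2pi z = 1" using exp_integer_2pi[of "of_int n"] by (simp add: e2pi_def mult_ac)
qed

lemma e2pi_1 [simp]: "e2pi 1 = 1" by (simp add: e2pi_eq_1_iff)

lemma e2pi_half: "e2pi (1/2) = -1" by (simp add: e2pi_def)

lemma e2pi_minus_half: "e2pi (- 1 / 2) = -1" using e2pi_half e2pi_minus[of "1/2"] by simp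

lemma e2pi_of_nat_mult: "e2pi (of_nat n * z) = e2pi z ^ n"
  by (simp add: e2pi_def flip: exp_of_nat_mult) (simp add: mult_ac)

lemma norm_e2pi: "norm (e2pi z) = exp (- 2 * pi * Im z)" by (simp add: e2pi_def)

lemma norm_e2pi_less_1 [simp]: "Im z > 0 \<Longrightarrow> norm (e2pi z) < 1" by (simp add: norm_e2pi)

lemma holomorphic_on_e2pi [holomorphic_intros]:
  "f holomorphic_on A \<Longrightarrow> (\<lambda>z. e2pi (f z)) holomorphic_on A"
  unfolding e2pi_def by (intro holomorphic_intros)

lemma DERIV_e2pi: "(e2pi has_field_derivative 2 * of_real pi * \<i> * e2pi z) (at z)"
  unfolding e2pi_def by (auto intro!: derivative_eq_intros)

lemma qpow_eq: "qpow \<tau> r = e2pi (of_real r * \<tau>)"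
  by (simp add: qpow_def e2pi_def mult_ac)

lemma zeta_powi_eq: "zeta p powi a = e2pi (of_int a / of_nat p)"
  unfolding zeta_def e2pi_def exp_power_int by (rule arg_cong[of _ _ exp]) simp

lemma e2pi_sum: "e2pi (\<Sum>x\<in>A. f x) = (\<Prod>x\<in>A. e2pi (f x))"
  by (cases "finite A") (simp_all add: e2pi_def sum_distrib_left exp_sum)

lemma e2pi_of_int_add [simp]: "e2pi (of_int n + z) = e2pi z"
  by (simp add: e2pi_add e2pi_eq_1_iff[THEN iffD2])

section \<open>q-Pochhammer products\<close>

text \<open>
  The q-Pochhammer symbol usually written \<open>(w; q)\<^sub>\<infinity>\<close>.
\<close>

definition qpoch :: "complex \<Rightarrow> complex \<Rightarrow> complex" where
  "qpoch w q = (\<Prod>n. 1 - w * q ^ n)"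

lemma abs_convergent_qpoch:
  fixes w q :: complex
  assumes "norm q < 1" shows "abs_convergent_prod (\<lambda>n. 1 - w * q ^ n)"
  using assms
  by (auto simp: abs_convergent_prod_conv_summable norm_mult norm_power
           intro!: summable_mult summable_geometric)

lemma convergent_qpoch:
  fixes w q :: complex
  shows "norm q < 1 \<Longrightarrow> convergent_prod (\<lambda>n. 1 - w * q ^ n)"
  using abs_convergent_qpoch abs_convergent_prod_imp_convergent_prod by blast

lemma has_prod_qpoch: "norm q < 1 \<Longrightarrow> (\<lambda>n. 1 - w * q ^ n) has_prod qpoch w q"
  unfolding qpoch_def using convergent_qpoch by blast

lemma qpoch_rec:
  assumes "norm q < 1" shows "qpoch w q = (1 - w) * qpoch (w * q) q"
proof -
  have "(\<lambda>n. 1 - w * q ^ Suc n) has_prod qpoch (w * q) q"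
    using has_prod_qpoch[OF assms, of "w * q"] by (simp add: mult_ac)
  from has_prod_Suc_imp[of "\<lambda>n. 1 - w * q ^ n", OF this]
  show ?thesis using has_prod_qpoch[OF assms, of w] has_prod_unique2 by (fastforce simp: mult_ac)
qed

lemma qpoch_nonzero:
  assumes "norm q < 1" "\<And>n. w * q ^ n \<noteq> 1" shows "qpoch w q \<noteq> 0"
  unfolding qpoch_def using prodinf_nonzero[OF convergent_qpoch[OF assms(1), of w]] assms(2)
  by (metis eq_iff_diff_eq_0)

lemma qpoch_nonzero_norm:
  assumes "norm q < 1" "norm w < 1" shows "qpoch w q \<noteq> 0"
proof (rule qpoch_nonzero[OF assms(1)])
  fix n
  have "norm (w * q ^ n) \<le> norm w * 1"
    unfolding norm_mult norm_power using assms by (intro mult_left_mono power_le_one) auto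
  also have "\<dots> < 1" using assms by simp
  finally show "w * q ^ n \<noteq> 1" by auto
qed

text \<open>
  Letting the base \<open>q\<close> vary along with \<open>w\<close> makes this serve twice: for theta quotients as functions
  of \<open>z\<close>, and for the constant in their inversion formula as a function of \<open>T\<close>. On a compact disc
  the deviations of the factors from \<open>1\<close> are dominated by a geometric series.
\<close>

lemma holomorphic_on_qpoch:
  assumes "open A" "f holomorphic_on A" "g holomorphic_on A" "\<And>z. z \<in> A \<Longrightarrow> norm (g z) < 1"
  shows "(\<lambda>z. qpoch (f z) (g z)) holomorphic_on A"
proof (rule holomorphic_uniform_sequence[OF assms(1)])
  show "(\<lambda>z. \<Prod>n<N. 1 - f z * g z ^ n) holomorphic_on A" for N
    by (intro holomorphic_intros assms)
next
  fix x assume x: "x \<in> A"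
  obtain d where d: "d > 0" "cball x d \<subseteq> A" using assms(1) x open_contains_cball by blast
  let ?K = "cball x d"
  have cf: "continuous_on ?K f" and cg: "continuous_on ?K g"
    using assms d holomorphic_on_imp_continuous_on continuous_on_subset by blast+
  obtain z0 where z0: "z0 \<in> ?K" "\<And>z. z \<in> ?K \<Longrightarrow> norm (g z) \<le> norm (g z0)"
    using continuous_attains_sup[of ?K "\<lambda>z. norm (g z)", OF _ _ continuous_on_norm[OF cg]] d by auto
  have r: "norm (g z0) < 1" using z0 d assms(4) by blast
  obtain B where B: "\<And>z. z \<in> ?K \<Longrightarrow> norm (f z) \<le> B"
    using compact_imp_bounded[OF compact_continuous_image[OF cf compact_cball]]
    unfolding bounded_iff by blast
  have "uniformly_convergent_on ?K (\<lambda>N z. \<Prod>n<N. 1 - f z * g z ^ n)"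
  proof (rule uniformly_convergent_on_prod')
    show "uniformly_convergent_on ?K (\<lambda>N z. \<Sum>n<N. norm (1 - f z * g z ^ n - 1))"
    proof (rule Weierstrass_m_test')
      show "summable (\<lambda>n. B * norm (g z0) ^ n)" using r by (intro summable_mult summable_geometric) auto
      show "norm (norm (1 - f z * g z ^ n - 1)) \<le> B * norm (g z0) ^ n" if "z \<in> ?K" for n z
        using that B[OF that] z0(2)[OF that]
        by (auto simp: norm_mult norm_power intro!: mult_mono power_mono intro: order_trans[OF norm_ge_zero])
    qed
  qed (use cf cg in \<open>auto intro!: continuous_intros\<close>)
  then obtain l where l: "uniform_limit ?K (\<lambda>N z. \<Prod>n<N. 1 - f z * g z ^ n) l sequentially"
    by (auto simp: uniformly_convergent_on_def)
  have "l z = qpoch (f z) (g z)" if "z \<in> ?K" for z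
  proof -
    have "(\<lambda>N. \<Prod>n<N. 1 - f z * g z ^ n) \<longlonglongrightarrow> l z" using tendsto_uniform_limitI[OF l that] .
    moreover have "(\<lambda>N. \<Prod>n<N. 1 - f z * g z ^ n) \<longlonglongrightarrow> qpoch (f z) (g z)"
      using has_prod_imp_tendsto'[OF has_prod_qpoch] assms(4) d that by blast
    ultimately show ?thesis using LIMSEQ_unique by blast
  qed
  then have "uniform_limit ?K (\<lambda>N z. \<Prod>n<N. 1 - f z * g z ^ n) (\<lambda>z. qpoch (f z) (g z)) sequentially"
    using l uniform_limit_cong'[of ?K] by (metis (no_types, lifting))
  then show "\<exists>d>0. cball x d \<subseteq> A \<and>
      uniform_limit (cball x d) (\<lambda>N z. \<Prod>n<N. 1 - f z * g z ^ n) (\<lambda>z. qpoch (f z) (g z)) sequentially"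
    using d by blast
qed

text \<open>
  The partial products of length \<open>k * N\<close> split exactly into the partial products of length \<open>N\<close>
  over the residue classes modulo \<open>k\<close>.
\<close>

lemma prodinf_residue_classes:
  fixes f :: "nat \<Rightarrow> complex"
  assumes "k > 0" "convergent_prod f" "\<And>r. r < k \<Longrightarrow> convergent_prod (\<lambda>n. f (k * n + r))"
  shows "prodinf f = (\<Prod>r<k. \<Prod>n. f (k * n + r))"
proof -
  have 1: "(\<Prod>i<k * N. f i) = (\<Prod>r<k. \<Prod>n<N. f (k * n + r))" for N
  proof -
    have block: "prod f {n * k..<n * k + k} = (\<Prod>r<k. f (k * n + r))" for n
      using prod.shift_bounds_nat_ivl[of f 0 "n * k" k]
      by (simp add: mult.commute add.commute atLeast0LessThan)
    have "(\<Prod>i<k * N. f i) = (\<Prod>n<N. \<Prod>r<k. f (k * n + r))"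
      using prod.nat_group[of f k N] unfolding block by (simp add: mult.commute)
    then show ?thesis by (simp only: prod.swap[of _ "{..<k}"])
  qed
  have "(\<lambda>N. \<Prod>i<N. f i) \<longlonglongrightarrow> prodinf f"
    using assms(2) has_prod_imp_tendsto' by blast
  then have "(\<lambda>N. \<Prod>i<k * N. f i) \<longlonglongrightarrow> prodinf f"
    using LIMSEQ_subseq_LIMSEQ[of _ _ "\<lambda>N. k * N"] assms(1) by (auto simp: strict_mono_def o_def)
  moreover have "(\<lambda>N. \<Prod>i<k * N. f i) \<longlonglongrightarrow> (\<Prod>r<k. \<Prod>n. f (k * n + r))"
    unfolding 1 using assms(3) has_prod_imp_tendsto' by (intro tendsto_prod) blast
  ultimately show ?thesis using LIMSEQ_unique by blast
qed

lemma qpoch_dissect: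
  assumes "norm q < 1" "k > 0"
  shows "qpoch w q = (\<Prod>r<k. qpoch (w * q ^ r) (q ^ k))"
proof -
  have qk: "norm (q ^ k) < 1" using assms by (simp add: norm_power power_less_one_iff)
  have eq: "1 - w * q ^ (k * n + r) = 1 - (w * q ^ r) * (q ^ k) ^ n" for n r
    by (simp add: power_add power_mult mult_ac)
  have "qpoch w q = (\<Prod>r<k. \<Prod>n. 1 - w * q ^ (k * n + r))"
    unfolding qpoch_def
    using assms convergent_qpoch[OF assms(1)] convergent_qpoch[OF qk]
    by (intro prodinf_residue_classes) (auto simp: eq)
  then show ?thesis by (simp add: eq qpoch_def)
qed

lemma qpoch_mult_neg:
  assumes "norm q < 1" shows "qpoch w q * qpoch (- w) q = qpoch (w\<^sup>2) (q\<^sup>2)"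
proof -
  have "norm (q\<^sup>2) < 1" using assms by (simp add: norm_power power_less_one_iff)
  have "qpoch w q * qpoch (- w) q = (\<Prod>n. (1 - w * q ^ n) * (1 - (- w) * q ^ n))"
    unfolding qpoch_def by (intro prodinf_mult convergent_qpoch assms)
  also have "\<dots> = qpoch (w\<^sup>2) (q\<^sup>2)"
    unfolding qpoch_def by (intro prodinf_cong) (simp add: algebra_simps power2_eq_square power_mult_distrib)
  finally show ?thesis .
qed

text \<open>
  With \<open>q = r\<^sup>2\<close> this is Euler's \<open>\<Prod> (1 + q^n) \<cdot> \<Prod> (1 - q^(2n-1)) = 1\<close>: both
  \<open>\<Prod> (1 - q^n) (1 + q^n)\<close> and the even part of \<open>\<Prod> (1 - q^n)\<close> equal \<open>\<Prod> (1 - q^(2n))\<close>. The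
  half-integral powers of \<open>q\<close> come from the points of order two.
\<close>

lemma euler_three_products:
  assumes "norm r < 1"
  shows "qpoch (- (r\<^sup>2)) (r\<^sup>2) * qpoch r (r\<^sup>2) * qpoch (- r) (r\<^sup>2) = 1"
proof -
  let ?q = "r\<^sup>2"
  have q: "norm ?q < 1" using assms by (simp add: norm_power power_less_one_iff)
  have q2: "norm (?q\<^sup>2) < 1" using q by (simp add: norm_power power_less_one_iff)
  have "qpoch ?q ?q = qpoch ?q (?q\<^sup>2) * qpoch (?q\<^sup>2) (?q\<^sup>2)"
    using qpoch_dissect[OF q, of 2 ?q] by (simp add: numeral_2_eq_2 lessThan_Suc mult_ac)
  moreover have "qpoch ?q ?q * qpoch (- ?q) ?q = qpoch (?q\<^sup>2) (?q\<^sup>2)" by (rule qpoch_mult_neg[OF q])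
  moreover have "qpoch r ?q * qpoch (- r) ?q = qpoch ?q (?q\<^sup>2)" using qpoch_mult_neg[OF q, of r] by simp
  moreover have "qpoch ?q ?q * (qpoch (- ?q) ?q * qpoch r ?q * qpoch (- r) ?q) =
      (qpoch ?q ?q * qpoch (- ?q) ?q) * (qpoch r ?q * qpoch (- r) ?q)" by (simp only: mult_ac)
  ultimately have "qpoch ?q ?q * (qpoch (- ?q) ?q * qpoch r ?q * qpoch (- r) ?q) = qpoch ?q ?q"
    by (simp only: mult_ac)
  moreover have "qpoch ?q ?q \<noteq> 0" using qpoch_nonzero_norm[OF q q] .
  ultimately show ?thesis by (simp add: mult_ac)
qed

section \<open>Entire functions with common quasi-periods\<close>

lemma shift_invariant_int:
  fixes w :: complex
  assumes "\<And>z. P (z + w) \<longleftrightarrow> P z" shows "P (z + of_int n * w) \<longleftrightarrow> P z"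
proof (induction n rule: int_induct[where k = 0])
  case (step1 i)
  then show ?case using assms[of "z + of_int i * w"] by (simp add: algebra_simps)
next
  case (step2 i)
  then show ?case using assms[of "z + of_int (i - 1) * w"] by (simp add: algebra_simps)
qed simp

lemma period_parallelogram:
  assumes "Im T > 0"
  obtains x y :: real and a b :: int where
    "0 \<le> x" "x < 1" "0 \<le> y" "y < 1" "z = of_real x + of_real y * T + of_int a * 1 + of_int b * T"
proof -
  define v where "v = Im z / Im T"
  define u where "u = Re z - v * Re T"
  have "z = of_real u + of_real v * T"
    using assms by (auto simp: complex_eq_iff u_def v_def)
  also have "\<dots> = of_real (frac u) + of_real (frac v) * T + of_int \<lfloor>u\<rfloor> * 1 + of_int \<lfloor>v\<rfloor> * T"
    by (simp add: frac_def algebra_simps)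
  finally show ?thesis using that[of "frac u" "frac v" "\<lfloor>u\<rfloor>" "\<lfloor>v\<rfloor>"] by (simp add: frac_lt_1)
qed

text \<open>
  At a simple zero of \<open>g\<close> that is also a zero of \<open>f\<close>, the quotient of the derivatives is the value
  that removes the singularity.
\<close>

definition extended_quotient :: "(complex \<Rightarrow> complex) \<Rightarrow> (complex \<Rightarrow> complex) \<Rightarrow> complex \<Rightarrow> complex"
  where
  "extended_quotient f g z = (if g z = 0 then deriv f z / deriv g z else f z / g z)"

text \<open>
  The term with the derivative of the multiplier drops out at a zero, so there the derivative is
  multiplied by \<open>u\<close> exactly as the function is.
\<close>

lemma deriv_quasi_period:
  assumes "f holomorphic_on UNIV" "u holomorphic_on UNIV" "\<And>z. f (z + w) = u z * f z" "f z = 0"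
  shows "deriv f (z + w) = u z * deriv f z"
proof -
  have d: "(f has_field_derivative deriv f x) (at x)" "(u has_field_derivative deriv u x) (at x)" for x
    using assms(1,2) holomorphic_derivI by blast+
  have "((\<lambda>x. f (x + w)) has_field_derivative deriv f (z + w)) (at z)"
    using d(1)[of "z + w"] by (simp add: DERIV_shift)
  moreover have "((\<lambda>x. f (x + w)) has_field_derivative u z * deriv f z) (at z)"
    unfolding assms(3) using assms(4) by (auto intro!: derivative_eq_intros d)
  ultimately show ?thesis using DERIV_unique by blast
qed

lemma holomorphic_on_extended_quotient:
  assumes f: "f holomorphic_on UNIV" and g: "g holomorphic_on UNIV"
    and z: "\<And>z. g z = 0 \<Longrightarrow> f z = 0 \<and> deriv g z \<noteq> 0"
  shows "extended_quotient f g holomorphic_on UNIV"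
proof -
  have "extended_quotient f g field_differentiable at a" for a
  proof (cases "g a = 0")
    case False
    have "open {x. g x \<noteq> 0}"
      using open_Collect_neq[OF holomorphic_on_imp_continuous_on[OF g] continuous_on_const, of 0] .
    moreover have "(\<lambda>x. f x / g x) holomorphic_on {x. g x \<noteq> 0}"
      by (intro holomorphic_intros holomorphic_on_subset[OF f] holomorphic_on_subset[OF g]) auto
    then have "extended_quotient f g holomorphic_on {x. g x \<noteq> 0}"
      by (rule holomorphic_transform) (auto simp: extended_quotient_def)
    ultimately show ?thesis using False holomorphic_on_imp_differentiable_at by blast
  next
    case True
    \<comment> \<open>Near a common zero \<open>a\<close>, divide numerator and denominator by \<open>x - a\<close>.\<close>
    define F where "F = (\<lambda>x. if x = a then deriv f a else (f x - f a) / (x - a))"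
    define H where "H = (\<lambda>x. if x = a then deriv g a else (g x - g a) / (x - a))"
    have FH: "F holomorphic_on UNIV" "H holomorphic_on UNIV"
      unfolding F_def H_def by (intro pole_lemma_open f g open_UNIV)+
    have op: "open {x. H x \<noteq> 0}"
      using open_Collect_neq[OF holomorphic_on_imp_continuous_on[OF FH(2)] continuous_on_const, of 0] .
    have "(\<lambda>x. F x / H x) holomorphic_on {x. H x \<noteq> 0}"
      by (intro holomorphic_intros holomorphic_on_subset[OF FH(1)] holomorphic_on_subset[OF FH(2)]) auto
    then have "extended_quotient f g holomorphic_on {x. H x \<noteq> 0}"
      by (rule holomorphic_transform) (use True z[OF True] in \<open>auto simp: extended_quotient_def F_def H_def split: if_splits\<close>)
    moreover have "H a \<noteq> 0" using z[OF True] by (simp add: H_def)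
    ultimately show ?thesis using op holomorphic_on_imp_differentiable_at by blast
  qed
  then show ?thesis by (simp add: holomorphic_on_def field_differentiable_at_within)
qed

text \<open>
  This is the fact that theta functions of degree one form a one-dimensional space, in the form
  needed here. The conditions on the zeros of \<open>g\<close> have to be checked in a fundamental
  parallelogram only, since zeros, their simplicity and the vanishing of \<open>f\<close> are transported
  by the periods; the extended quotient \<open>f / g\<close> is then entire and doubly periodic, hence bounded,
  and Liouville's theorem applies.
\<close>

lemma quasi_periodic_proportional:
  assumes f: "f holomorphic_on UNIV" and g: "g holomorphic_on UNIV"
    and u: "u holomorphic_on UNIV" "\<And>z. u z \<noteq> 0" and v: "v holomorphic_on UNIV" "\<And>z. v z \<noteq> 0"
    and T: "Im T > 0"
    and per_f: "\<And>z. f (z + 1) = u z * f z" "\<And>z. f (z + T) = v z * f z"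
    and per_g: "\<And>z. g (z + 1) = u z * g z" "\<And>z. g (z + T) = v z * g z"
    and zero: "\<And>x y. 0 \<le> x \<Longrightarrow> x < 1 \<Longrightarrow> 0 \<le> y \<Longrightarrow> y < 1 \<Longrightarrow>
                 g (of_real x + of_real y * T) = 0 \<Longrightarrow> x = 0 \<and> y = 0"
    and at_0: "f 0 = 0" "deriv g 0 \<noteq> 0"
  shows "\<exists>c. \<forall>z. f z = c * g z"
proof -
  \<comment> \<open>The property that makes the singularity of \<open>f / g\<close> at \<open>z\<close> removable; it is invariant
    under both periods.\<close>
  define good where "good = (\<lambda>z. g z = 0 \<longrightarrow> f z = 0 \<and> deriv g z \<noteq> 0)"
  have sh1: "good (z + 1) \<longleftrightarrow> good z" for z
    unfolding good_def per_f(1) per_g(1)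
    using u(2)[of z] deriv_quasi_period[OF g u(1) per_g(1), of z] by auto
  have shT: "good (z + T) \<longleftrightarrow> good z" for z
    unfolding good_def per_f(2) per_g(2)
    using v(2)[of z] deriv_quasi_period[OF g v(1) per_g(2), of z] by auto
  have good: "good z" for z
  proof -
    obtain x y a b where xy: "0 \<le> x" "x < 1" "0 \<le> y" "y < 1"
      and z: "z = of_real x + of_real y * T + of_int a * 1 + of_int b * T"
      using period_parallelogram[OF T] by metis
    have "good (of_real x + of_real y * T)"
      using zero[OF xy] at_0 by (auto simp: good_def)
    then show ?thesis unfolding z
      using shift_invariant_int[of good, OF shT] shift_invariant_int[of good, OF sh1] by blast
  qed
  let ?Q = "extended_quotient f g"
  have holQ: "?Q holomorphic_on UNIV"
    using good by (intro holomorphic_on_extended_quotient f g) (auto simp: good_def)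
  have Q1: "?Q (z + 1) = ?Q z" for z
  proof (cases "g z = 0")
    case True
    then have "f z = 0" using good by (auto simp: good_def)
    then show ?thesis
      using True u(2)[of z] deriv_quasi_period[OF g u(1) per_g(1) True]
        deriv_quasi_period[OF f u(1) per_f(1)]
      by (simp add: extended_quotient_def per_g)
  qed (use u(2)[of z] in \<open>simp add: extended_quotient_def per_g per_f\<close>)
  have QT: "?Q (z + T) = ?Q z" for z
  proof (cases "g z = 0")
    case True
    then have "f z = 0" using good by (auto simp: good_def)
    then show ?thesis
      using True v(2)[of z] deriv_quasi_period[OF g v(1) per_g(2) True]
        deriv_quasi_period[OF f v(1) per_f(2)]
      by (simp add: extended_quotient_def per_g)
  qed (use v(2)[of z] in \<open>simp add: extended_quotient_def per_g per_f\<close>)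
  define K where "K = (\<lambda>(x, y). complex_of_real x + of_real y * T) ` ({0..1} \<times> {0..1})"
  have "compact K" unfolding K_def
    by (intro compact_continuous_image compact_Times)
       (auto simp: case_prod_unfold intro!: continuous_intros)
  then have "compact (?Q ` K)"
    using holQ holomorphic_on_imp_continuous_on continuous_on_subset
    by (metis compact_continuous_image subset_UNIV)
  then have "bounded (?Q ` K)" by (rule compact_imp_bounded)
  then obtain B where B: "\<And>z. z \<in> K \<Longrightarrow> norm (?Q z) \<le> B"
    by (auto simp: bounded_iff)
  have "norm (?Q z) \<le> B" for z
  proof -
    obtain x y a b where xy: "0 \<le> x" "x < 1" "0 \<le> y" "y < 1"
      and z: "z = of_real x + of_real y * T + of_int a * 1 + of_int b * T"
      using period_parallelogram[OF T] by metis
    have "norm (?Q (of_real x + of_real y * T)) \<le> B"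
      unfolding K_def using xy by (intro B[unfolded K_def] image_eqI[of _ _ "(x, y)"]) auto
    then show ?thesis unfolding z
      using shift_invariant_int[of "\<lambda>z. norm (?Q z) \<le> B" T]
        shift_invariant_int[of "\<lambda>z. norm (?Q z) \<le> B" 1]
        Q1 QT by simp
  qed
  then have "bounded (range ?Q)" by (auto simp: bounded_iff)
  from Liouville_theorem[OF holQ this] obtain c where c: "\<And>z. ?Q z = c"
    by (auto simp: constant_on_def)
  have "f z = c * g z" for z
    using c[of z] good by (cases "g z = 0") (auto simp: extended_quotient_def good_def)
  then show ?thesis by blast
qed

section \<open>The quotient of theta by eta and its inversion formula\<close>

text \<open>
  This is \<open>\<theta>\<^sub>1(z, T) / \<eta>(T)\<close>; the factors \<open>\<i> * e2pi (- z / 2) * (1 - e2pi z)\<close> amount to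
  \<open>2 sin (\<pi> z)\<close>, written so that the simple zero at \<open>z = 0\<close> is visible.
\<close>

definition theta_quot :: "complex \<Rightarrow> complex \<Rightarrow> complex" where
  "theta_quot z T = \<i> * e2pi (- z / 2) * e2pi (T / 12) * (1 - e2pi z) *
    qpoch (e2pi (T + z)) (e2pi T) * qpoch (e2pi (T - z)) (e2pi T)"

text \<open>
  Absorbing \<open>1 - e2pi z\<close> into the first infinite product makes the shift by \<open>T\<close> a shift of the
  index.
\<close>

lemma theta_quot_alt:
  assumes "Im T > 0"
  shows "theta_quot z T = \<i> * e2pi (- z / 2) * e2pi (T / 12) *
    qpoch (e2pi z) (e2pi T) * qpoch (e2pi (T - z)) (e2pi T)"
  using qpoch_rec[OF norm_e2pi_less_1[OF assms], of "e2pi z"] by (simp add: theta_quot_def e2pi_add mult_ac)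

lemma theta_quot_0 [simp]: "theta_quot 0 T = 0" by (simp add: theta_quot_def)

lemma theta_quot_minus: "theta_quot (- z) T = - theta_quot z T"
proof -
  have "e2pi (z / 2) * (1 - e2pi (- z)) = - (e2pi (- z / 2) * (1 - e2pi z))"
  proof -
    have "e2pi z = e2pi (z / 2) * e2pi (z / 2)" by (simp flip: e2pi_add)
    then show ?thesis by (simp add: e2pi_minus field_simps)
  qed
  moreover have "theta_quot (- z) T = \<i> * e2pi (T / 12) * (e2pi (z / 2) * (1 - e2pi (- z))) *
      qpoch (e2pi (T + z)) (e2pi T) * qpoch (e2pi (T - z)) (e2pi T)"
    by (simp add: theta_quot_def mult_ac)
  ultimately show ?thesis by (simp add: theta_quot_def mult_ac)
qed

lemma theta_quot_add_1: "theta_quot (z + 1) T = - theta_quot z T"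
proof -
  have "- (z + 1) / 2 = - z / 2 + - 1 / 2" by (simp add: field_simps)
  then have "e2pi (- (z + 1) / 2) = - e2pi (- z / 2)" by (simp only: e2pi_add e2pi_minus_half) simp
  moreover have "e2pi (T + (z + 1)) = e2pi (T + z)" "e2pi (T - (z + 1)) = e2pi (T - z)"
    by (simp_all add: e2pi_add e2pi_diff)
  ultimately show ?thesis unfolding theta_quot_def by (simp add: e2pi_add)
qed

lemma theta_quot_add_T:
  assumes "Im T > 0" shows "theta_quot (z + T) T = - e2pi (- z - T / 2) * theta_quot z T"
proof -
  have 1: "qpoch (e2pi (T - (z + T))) (e2pi T) = (1 - e2pi (- z)) * qpoch (e2pi (T - z)) (e2pi T)"
    using qpoch_rec[OF norm_e2pi_less_1[OF assms], of "e2pi (- z)"] by (simp add: e2pi_diff e2pi_minus field_simps)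
  have 2: "e2pi (- (z + T) / 2) = e2pi (- z / 2) * e2pi (- T / 2)"
    unfolding e2pi_add[symmetric] by (rule arg_cong[of _ _ e2pi]) (simp add: field_simps)
  have 3: "1 - e2pi (- z) = - e2pi (- z) * (1 - e2pi z)" by (simp add: e2pi_minus field_simps)
  have 4: "e2pi (- z - T / 2) = e2pi (- z) * e2pi (- T / 2)"
    unfolding e2pi_add[symmetric] by (rule arg_cong[of _ _ e2pi]) (simp add: field_simps)
  show ?thesis
    unfolding theta_quot_alt[OF assms, of "z + T"] unfolding theta_quot_def 1 2 3 4
    by (simp add: add.commute mult_ac)
qed

lemma theta_quot_diff_T:
  assumes "Im T > 0" shows "theta_quot (z - T) T = - e2pi (z - T / 2) * theta_quot z T"
  using theta_quot_add_T[OF assms, of "- z"] theta_quot_minus[of z T] theta_quot_minus[of "z - T" T] by simp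

lemma holomorphic_on_theta_quot:
  assumes "open A" "f holomorphic_on A" "g holomorphic_on A" "\<And>z. z \<in> A \<Longrightarrow> Im (g z) > 0"
  shows "(\<lambda>z. theta_quot (f z) (g z)) holomorphic_on A"
  unfolding theta_quot_def using assms by (intro holomorphic_intros holomorphic_on_qpoch) auto

lemma theta_quot_zero_parallelogram:
  assumes T: "Im T > 0" and xy: "0 \<le> x" "x < 1" "0 \<le> y" "y < 1"
    and zero: "theta_quot (of_real x + of_real y * T) T = 0"
  shows "x = 0 \<and> y = 0"
proof -
  let ?z = "of_real x + of_real y * T"
  have q: "norm (e2pi T) < 1" using T by simp
  have "Im ?z \<ge> 0" using T xy by simp
  then have "norm (e2pi (T + ?z)) < 1" using T by (intro norm_e2pi_less_1) simp
  from qpoch_nonzero_norm[OF q this] have 1: "qpoch (e2pi (T + ?z)) (e2pi T) \<noteq> 0" .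
  have "Im (T - ?z) = (1 - y) * Im T" by (simp add: algebra_simps)
  then have "norm (e2pi (T - ?z)) < 1" using T xy by (intro norm_e2pi_less_1) simp
  from qpoch_nonzero_norm[OF q this] have 2: "qpoch (e2pi (T - ?z)) (e2pi T) \<noteq> 0" .
  have "e2pi ?z = 1" using zero 1 2 by (simp add: theta_quot_def)
  then obtain n where n: "?z = of_int n" by (auto simp: e2pi_eq_1_iff elim: Ints_cases)
  have "Im ?z = Im (of_int n)" by (simp only: n)
  then have "y * Im T = 0" by simp
  then have "y = 0" using T by simp
  have "Re ?z = Re (of_int n)" by (simp only: n)
  then have "x = of_int n" using \<open>y = 0\<close> by simp
  then have "n = 0" using xy by linarith
  then show ?thesis using \<open>x = of_int n\<close> \<open>y = 0\<close> by simp
qed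

text \<open>
  Only the factor \<open>1 - e2pi z\<close> vanishes at \<open>0\<close>, and it does so to first order.
\<close>

lemma deriv_theta_quot_0:
  assumes T: "Im T > 0"
  shows "deriv (\<lambda>z. theta_quot z T) 0 \<noteq> 0"
proof -
  have q: "norm (e2pi T) < 1" using T by simp
  define h where "h = (\<lambda>z. \<i> * e2pi (- z / 2) * e2pi (T / 12) *
      qpoch (e2pi (T + z)) (e2pi T) * qpoch (e2pi (T - z)) (e2pi T))"
  have "h holomorphic_on UNIV" unfolding h_def
    using q by (intro holomorphic_intros holomorphic_on_qpoch open_UNIV) auto
  then have "(h has_field_derivative deriv h 0) (at 0)" using holomorphic_derivI by blast
  then have "((\<lambda>z. (1 - e2pi z) * h z) has_field_derivative - (2 * of_real pi * \<i>) * h 0) (at 0)"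
    by (auto intro!: derivative_eq_intros DERIV_e2pi)
  moreover have "(\<lambda>z. theta_quot z T) = (\<lambda>z. (1 - e2pi z) * h z)" by (simp add: theta_quot_def h_def fun_eq_iff mult_ac)
  ultimately have "deriv (\<lambda>z. theta_quot z T) 0 = - (2 * of_real pi * \<i>) * h 0" by (simp add: DERIV_imp_deriv)
  moreover have "h 0 \<noteq> 0" unfolding h_def using qpoch_nonzero_norm[OF q q] by simp
  ultimately show ?thesis by simp
qed

lemma Im_inversion: "Im T > 0 \<Longrightarrow> Im (- 1 / T) > 0"
  by (auto simp: Im_divide sum_power2_gt_zero_iff intro!: divide_pos_pos)

text \<open>
  The other side of the inversion formula; the Gaussian factor is the one that turns the multipliers
  for the lattice \<open>\<int> + \<int>(-1/T)\<close>, scaled by \<open>T\<close>, into those of \<open>theta_quot\<close>.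
\<close>

definition theta_quot_inv :: "complex \<Rightarrow> complex \<Rightarrow> complex" where
  "theta_quot_inv z T = e2pi (- (z\<^sup>2) / (2 * T)) * theta_quot (z / T) (- 1 / T)"

lemma theta_quot_inversion_const:
  assumes T: "Im T > 0" shows "\<exists>c. \<forall>z. theta_quot_inv z T = c * theta_quot z T"
proof (rule quasi_periodic_proportional[where u = "\<lambda>z. -1" and v = "\<lambda>z. - e2pi (- z - T / 2)" and T = T])
  have T0: "T \<noteq> 0" using T by auto
  have T': "Im (- 1 / T) > 0" using T by (rule Im_inversion)
  show "(\<lambda>z. theta_quot_inv z T) holomorphic_on UNIV" unfolding theta_quot_inv_def
    using T0 T' by (intro holomorphic_intros holomorphic_on_theta_quot open_UNIV) auto
  show "(\<lambda>z. theta_quot z T) holomorphic_on UNIV"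
    using T by (intro holomorphic_on_theta_quot holomorphic_intros open_UNIV) auto
  show "theta_quot_inv (z + 1) T = - 1 * theta_quot_inv z T" for z
  proof -
    have "theta_quot ((z + 1) / T) (- 1 / T) = - e2pi (z / T + 1 / (2 * T)) * theta_quot (z / T) (- 1 / T)"
      using theta_quot_diff_T[OF T', of "z / T"] by (simp add: add_divide_distrib mult.commute)
    moreover have "e2pi (- ((z + 1)\<^sup>2) / (2 * T)) * e2pi (z / T + 1 / (2 * T)) = e2pi (- (z\<^sup>2) / (2 * T))"
      unfolding e2pi_add[symmetric]
      by (rule arg_cong[of _ _ e2pi]) (use T0 in \<open>simp add: field_simps power2_eq_square\<close>)
    ultimately show ?thesis unfolding theta_quot_inv_def by (simp add: mult.assoc[symmetric])
  qed
  show "theta_quot_inv (z + T) T = - e2pi (- z - T / 2) * theta_quot_inv z T" for z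
  proof -
    have "theta_quot ((z + T) / T) (- 1 / T) = - theta_quot (z / T) (- 1 / T)"
      using theta_quot_add_1[of "z / T"] T0 by (simp add: add_divide_distrib)
    moreover have "e2pi (- ((z + T)\<^sup>2) / (2 * T)) = e2pi (- z - T / 2) * e2pi (- (z\<^sup>2) / (2 * T))"
      unfolding e2pi_add[symmetric]
      by (rule arg_cong[of _ _ e2pi]) (use T0 in \<open>simp add: field_simps power2_eq_square\<close>)
    ultimately show ?thesis unfolding theta_quot_inv_def by simp
  qed
  show "x = 0 \<and> y = 0" if "0 \<le> x" "x < 1" "0 \<le> y" "y < 1" "theta_quot (of_real x + of_real y * T) T = 0" for x y
    using theta_quot_zero_parallelogram[OF T] that by blast
qed (use T theta_quot_add_T[OF T] deriv_theta_quot_0[OF T] in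
     \<open>auto intro!: holomorphic_intros simp: theta_quot_add_1 theta_quot_inv_def\<close>)

lemma e2pi_quarter: "e2pi (- 1 / 4) = - \<i>"
  by (simp add: e2pi_def exp_eq_polar cis.ctr complex_eq_iff exp_Euler)

text \<open>
  The three values carry the squares of the three products in Euler's identity, which
  therefore cancel and leave an exponential.
\<close>

lemma theta_quot_two_torsion:
  assumes T: "Im T > 0"
  shows "theta_quot (1 / 2) T * theta_quot (T / 2) T * theta_quot ((1 + T) / 2) T = 2 * \<i> * e2pi (- T / 4)"
proof -
  define r where "r = e2pi (T / 2)"
  have q: "e2pi T = r\<^sup>2" by (simp add: r_def power2_eq_square flip: e2pi_add)
  have r: "norm r < 1" unfolding r_def using T by (intro norm_e2pi_less_1) simp
  have 1: "theta_quot (1 / 2) T = 2 * e2pi (T / 12) * (qpoch (- (r\<^sup>2)) (r\<^sup>2))\<^sup>2"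
    using e2pi_quarter by (simp add: theta_quot_def e2pi_add e2pi_diff e2pi_half q power2_eq_square)
  have 2: "theta_quot (T / 2) T = \<i> * e2pi (- T / 4) * e2pi (T / 12) * (qpoch r (r\<^sup>2))\<^sup>2"
    unfolding theta_quot_alt[OF T] by (simp add: q r_def[symmetric] power2_eq_square)
  have 3: "theta_quot ((1 + T) / 2) T = e2pi (- T / 4) * e2pi (T / 12) * (qpoch (- r) (r\<^sup>2))\<^sup>2"
  proof -
    have "e2pi ((1 + T) / 2) = - r" by (simp add: add_divide_distrib e2pi_add e2pi_half r_def)
    moreover have "e2pi (T - (1 + T) / 2) = - r"
    proof -
      have "T - (1 + T) / 2 = - 1 / 2 + T / 2" by (simp add: field_simps)
      then show ?thesis by (simp only: e2pi_add e2pi_minus_half r_def) simp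
    qed
    moreover have "e2pi (- ((1 + T) / 2) / 2) = - \<i> * e2pi (- T / 4)"
    proof -
      have "- ((1 + T) / 2) / 2 = - 1 / 4 + - T / 4" by (simp add: field_simps)
      then show ?thesis by (simp only: e2pi_add e2pi_quarter)
    qed
    ultimately show ?thesis unfolding theta_quot_alt[OF T] by (simp add: q power2_eq_square)
  qed
  have "theta_quot (1 / 2) T * theta_quot (T / 2) T * theta_quot ((1 + T) / 2) T =
      2 * \<i> * (e2pi (T / 12) ^ 3 * e2pi (- T / 4) ^ 2) *
        (qpoch (- (r\<^sup>2)) (r\<^sup>2) * qpoch r (r\<^sup>2) * qpoch (- r) (r\<^sup>2))\<^sup>2"
    unfolding 1 2 3 by (simp add: power2_eq_square power3_eq_cube)
  also have "e2pi (T / 12) ^ 3 * e2pi (- T / 4) ^ 2 = e2pi (- T / 4)"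
    unfolding power2_eq_square power3_eq_cube e2pi_add[symmetric]
    by (rule arg_cong[of _ _ e2pi]) (simp add: field_simps)
  finally show ?thesis using euler_three_products[OF r] by simp
qed

text \<open>
  The map \<open>z \<mapsto> z / T\<close> permutes the classes of the points of order two, so this reduces to the
  previous evaluation at \<open>-1/T\<close>.
\<close>

lemma theta_quot_inv_two_torsion:
  assumes T: "Im T > 0"
  shows "theta_quot_inv (1 / 2) T * theta_quot_inv (T / 2) T * theta_quot_inv ((1 + T) / 2) T = - 2 * e2pi (- T / 4)"
proof -
  define T' where "T' = - 1 / T"
  have T0: "T \<noteq> 0" using T by auto
  have T': "Im T' > 0" unfolding T'_def using T by (rule Im_inversion)
  have 1: "theta_quot_inv (1 / 2) T = - e2pi (T' / 8) * theta_quot (T' / 2) T'"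
    using theta_quot_minus[of "T' / 2" T'] by (simp add: theta_quot_inv_def T'_def power2_eq_square mult_ac)
  have 2: "theta_quot_inv (T / 2) T = e2pi (- T / 8) * theta_quot (1 / 2) T'"
    using T0 by (simp add: theta_quot_inv_def T'_def power2_eq_square)
  have 3: "theta_quot_inv ((1 + T) / 2) T = e2pi (T' / 8) * e2pi (- T / 8) * - \<i> * theta_quot ((1 + T') / 2) T'"
  proof -
    have "(1 + T) / 2 / T = (1 + T') / 2 - T'" using T0 by (simp add: T'_def field_simps)
    then have "theta_quot ((1 + T) / 2 / T) T' = - e2pi ((1 + T') / 2 - T' / 2) * theta_quot ((1 + T') / 2) T'"
      using theta_quot_diff_T[OF T', of "(1 + T') / 2"] by simp
    also have "(1 + T') / 2 - T' / 2 = 1 / 2" by (simp add: field_simps)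
    finally have "theta_quot ((1 + T) / 2 / T) T' = theta_quot ((1 + T') / 2) T'" using e2pi_half by simp
    moreover have "e2pi (- (((1 + T) / 2)\<^sup>2) / (2 * T)) = e2pi (T' / 8) * e2pi (- T / 8) * e2pi (- 1 / 4)"
      unfolding e2pi_add[symmetric]
      by (rule arg_cong[of _ _ e2pi]) (use T0 in \<open>simp add: T'_def field_simps power2_eq_square\<close>)
    ultimately show ?thesis unfolding theta_quot_inv_def T'_def[symmetric] e2pi_quarter by simp
  qed
  have "theta_quot_inv (1 / 2) T * theta_quot_inv (T / 2) T * theta_quot_inv ((1 + T) / 2) T =
      \<i> * (e2pi (T' / 8) ^ 2 * e2pi (- T / 8) ^ 2) *
        (theta_quot (1 / 2) T' * theta_quot (T' / 2) T' * theta_quot ((1 + T') / 2) T')"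
    unfolding 1 2 3 by (simp add: power2_eq_square)
  also have "\<dots> = - 2 * (e2pi (T' / 8) ^ 2 * e2pi (- T / 8) ^ 2 * e2pi (- T' / 4))"
    unfolding theta_quot_two_torsion[OF T'] by simp
  \<comment> \<open>The contributions \<open>2/8\<close> and \<open>-1/4\<close> to the coefficient of \<open>T'\<close> cancel.\<close>
  also have "e2pi (T' / 8) ^ 2 * e2pi (- T / 8) ^ 2 * e2pi (- T' / 4) = e2pi (- T / 4)"
    unfolding power2_eq_square e2pi_add[symmetric]
    by (rule arg_cong[of _ _ e2pi]) (simp add: field_simps)
  finally show ?thesis .
qed

theorem theta_quot_inversion:
  assumes T: "Im T > 0" shows "theta_quot_inv z T = - \<i> * theta_quot z T"
proof -
  let ?H = "{T. Im T > 0}"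
  \<comment> \<open>Any point off the lattice serves to express the constant as a holomorphic function of \<open>T\<close>.\<close>
  define c where "c = (\<lambda>T. theta_quot_inv (1 / 2) T / theta_quot (1 / 2) T)"
  have nz: "theta_quot (1 / 2) T \<noteq> 0" if "Im T > 0" for T
    using theta_quot_zero_parallelogram[OF that, of "1 / 2" 0] by auto
  have c: "theta_quot_inv z T = c T * theta_quot z T" if "Im T > 0" for z T
    using theta_quot_inversion_const[OF that] nz[OF that] unfolding c_def by (metis nonzero_eq_divide_eq)
  have c3: "c T ^ 3 = \<i>" if "Im T > 0" for T
  proof -
    have "c T ^ 3 * (2 * \<i> * e2pi (- T / 4)) = - 2 * e2pi (- T / 4)"
      using theta_quot_inv_two_torsion[OF that] unfolding c[OF that] theta_quot_two_torsion[OF that, symmetric]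
      by (simp add: power3_eq_cube mult_ac)
    moreover have "- 2 * e2pi (- T / 4) = \<i> * (2 * \<i> * e2pi (- T / 4))" by (simp add: complex_eq_iff)
    ultimately have "c T ^ 3 * (2 * \<i> * e2pi (- T / 4)) = \<i> * (2 * \<i> * e2pi (- T / 4))"
      by (rule trans)
    moreover have "2 * \<i> * e2pi (- T / 4) \<noteq> 0" by simp
    ultimately show ?thesis by (metis mult_right_cancel)
  qed
  have opH: "open ?H" using open_halfspace_Im_gt by blast
  have "c holomorphic_on ?H" unfolding c_def theta_quot_inv_def
    using opH nz Im_inversion by (intro holomorphic_intros holomorphic_on_theta_quot) auto
  then have "continuous_on ?H c" by (rule holomorphic_on_imp_continuous_on)
  moreover have "connected ?H" using convex_connected[OF convex_halfspace_Im_gt] .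
  moreover have "finite (c ` ?H)"
    by (rule finite_subset[OF _ finite_nth_roots[of 3 \<i>]]) (use c3 in auto)
  ultimately have "c constant_on ?H"
    using continuous_finite_range_constant by blast
  then have const: "c T = c \<i>" using T unfolding constant_on_def by auto
  \<comment> \<open>For \<open>T = \<i>\<close> both sides involve the same function, and \<open>z \<mapsto> z / \<i>\<close> has derivative \<open>- \<i>\<close>.\<close>
  have "c \<i> = - \<i>"
  proof -
    have "(\<lambda>z. theta_quot z \<i>) holomorphic_on UNIV"
      by (intro holomorphic_on_theta_quot holomorphic_intros open_UNIV) auto
    then have d: "((\<lambda>z. theta_quot z \<i>) has_field_derivative deriv (\<lambda>z. theta_quot z \<i>) 0) (at 0)"
      using holomorphic_derivI by blast
    have d': "((\<lambda>z. theta_quot (z / \<i>) \<i>) has_field_derivative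
        deriv (\<lambda>z. theta_quot z \<i>) 0 * (1 / \<i>)) (at 0)"
      by (rule DERIV_chain2[where f = "\<lambda>z. theta_quot z \<i>" and g = "\<lambda>z. z / \<i>"])
         (use d in \<open>auto intro!: derivative_eq_intros\<close>)
    have e: "((\<lambda>z. e2pi (- (z\<^sup>2) / (2 * \<i>))) has_field_derivative 0) (at 0)"
      unfolding e2pi_def by (auto intro!: derivative_eq_intros)
    have "((\<lambda>z. theta_quot_inv z \<i>) has_field_derivative
        deriv (\<lambda>z. theta_quot z \<i>) 0 * (1 / \<i>)) (at 0)"
      unfolding theta_quot_inv_def using DERIV_mult[OF e d'] by simp
    moreover have "((\<lambda>z. theta_quot_inv z \<i>) has_field_derivative c \<i> * deriv (\<lambda>z. theta_quot z \<i>) 0) (at 0)"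
      using DERIV_cmult[OF d, of "c \<i>"] c[of \<i>] by simp
    ultimately have "deriv (\<lambda>z. theta_quot z \<i>) 0 * (1 / \<i>) = c \<i> * deriv (\<lambda>z. theta_quot z \<i>) 0"
      using DERIV_unique by blast
    then have "- \<i> * deriv (\<lambda>z. theta_quot z \<i>) 0 = c \<i> * deriv (\<lambda>z. theta_quot z \<i>) 0"
      by (simp add: mult.commute)
    moreover have "deriv (\<lambda>z. theta_quot z \<i>) 0 \<noteq> 0" by (rule deriv_theta_quot_0) simp
    ultimately show ?thesis by (metis mult_right_cancel)
  qed
  then show ?thesis using c[OF T] const by simp
qed

section \<open>Products over roots of unity and of sines\<close>

lemma prod_diff_roots_unity:
  assumes "n > 0"
  shows "(\<Prod>k<n. 1 - e2pi (of_nat k / of_nat n) * x) = 1 - x ^ n"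
proof -
  define \<omega> where "\<omega> = (\<lambda>k::nat. e2pi (of_nat k / of_nat n))"
  have cis: "\<omega> k = cis (2 * pi * real k / real n)" for k
    by (simp add: \<omega>_def e2pi_def cis_conv_exp mult_ac)
  have bij: "bij_betw \<omega> {..<n} {z. z ^ n = 1}"
    using Complex.bij_betw_roots_unity[OF assms] unfolding cis .
  let ?P = "Polynomial.monom 1 n - 1 :: complex poly" and ?Q = "\<Prod>k<n. [:- \<omega> k, 1:]"
  have degP: "degree ?P \<le> n" "poly.coeff ?P n = 1"
    using assms by (auto intro!: degree_diff_le degree_monom_le)
  have degQ: "degree ?Q = n" "lead_coeff ?Q = 1"
    by (simp_all only: degree_prod_eq_sum_degree lead_coeff_prod) (simp_all add: degree_prod_eq_sum_degree)
  have "?P = ?Q"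
  proof (rule poly_eqI_degree_lead_coeff[where A = "{z. z ^ n = 1}" and n = n])
    show "poly ?P z = poly ?Q z" if "z \<in> {z. z ^ n = 1}" for z
    proof -
      have "z \<in> \<omega> ` {..<n}" using that bij by (simp only: bij_betw_def)
      then obtain k where "k < n" "z = \<omega> k" by blast
      then have "poly ?Q z = 0" by (auto simp: poly_prod)
      then show ?thesis using that by (simp add: poly_monom)
    qed
  qed (use degP degQ card_roots_unity_eq[OF assms] in auto)
  then have "poly ?P y = poly ?Q y" for y by (simp only:)
  then have *: "y ^ n - 1 = (\<Prod>k<n. y - \<omega> k)" for y by (simp add: poly_monom poly_prod)
  show ?thesis
  proof (cases "x = 0")
    case False
    have "(\<Prod>k<n. 1 - \<omega> k * x) = (\<Prod>k<n. x * (1 / x - \<omega> k))"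
      using False by (intro prod.cong) (auto simp: field_simps)
    also have "\<dots> = x ^ n * ((1 / x) ^ n - 1)" by (simp add: prod.distrib *)
    also have "\<dots> = 1 - x ^ n" using False by (simp add: field_simps)
    finally show ?thesis by (simp add: \<omega>_def)
  qed (use assms in simp)
qed

text \<open>
  Cancelling \<open>1 - x\<close> from the factorisation of \<open>1 - x ^ n\<close> leaves a geometric sum, whose limit at
  \<open>x = 1\<close> is \<open>n\<close>.
\<close>

lemma prod_diff_nontrivial_roots_unity:
  assumes "n > 0"
  shows "(\<Prod>k\<in>{1..<n}. 1 - e2pi (of_nat k / of_nat n)) = of_nat n"
proof -
  let ?f = "\<lambda>x. \<Prod>k\<in>{1..<n}. 1 - e2pi (of_nat k / of_nat n) * x"
    and ?g = "\<lambda>x::complex. \<Sum>k<n. x ^ k"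
  have eq: "?f x = ?g x" if "x \<noteq> 1" for x
  proof -
    have "{..<n} = insert 0 {1..<n}" using assms by auto
    then have "1 - x ^ n = (1 - x) * ?f x"
      using prod_diff_roots_unity[OF assms, of x] by simp
    also have "1 - x ^ n = (1 - x) * ?g x" by (rule one_diff_power_eq)
    finally show ?thesis using that by simp
  qed
  have "?f \<midarrow>1\<rightarrow> ?f 1" by (intro tendsto_intros)
  moreover have "?g \<midarrow>1\<rightarrow> ?g 1" by (intro tendsto_intros)
  then have "?f \<midarrow>1\<rightarrow> ?g 1"
    by (rule Lim_transform_eventually) (use eq in \<open>auto simp: eventually_at_filter\<close>)
  ultimately show ?thesis using LIM_unique by fastforce
qed

lemma e2pi_minus_diff:
  "e2pi (- of_real (x / 2)) - e2pi (of_real (x / 2)) = - 2 * \<i> * of_real (sin (pi * x))"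
  by (simp add: e2pi_def sin_of_real[symmetric] sin_exp_eq mult_ac diff_divide_distrib
        right_diff_distrib flip: of_real_mult)

lemma norm_one_minus_e2pi: "norm (1 - e2pi (of_real x)) = 2 * \<bar>sin (pi * x)\<bar>"
proof -
  have "1 - e2pi (of_real x) = e2pi (of_real (x / 2)) * (e2pi (- of_real (x / 2)) - e2pi (of_real (x / 2)))"
    by (simp add: algebra_simps flip: e2pi_add)
  also note e2pi_minus_diff
  finally show ?thesis by (simp add: norm_mult norm_e2pi)
qed

lemma prod_two_sin:
  assumes "n > 0"
  shows "(\<Prod>k\<in>{1..<n}. 2 * sin (pi * real k / real n)) = real n"
proof -
  have "norm (1 - e2pi (of_nat k / of_nat n)) = 2 * sin (pi * real k / real n)" if "k \<in> {1..<n}" for k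
  proof -
    have "sin (pi * (real k / real n)) \<ge> 0"
      using that mult_left_le[of "real k / real n" pi] by (intro sin_ge_zero) auto
    then show ?thesis using norm_one_minus_e2pi[of "real k / real n"] by simp
  qed
  then have "(\<Prod>k\<in>{1..<n}. 2 * sin (pi * real k / real n)) =
      (\<Prod>k\<in>{1..<n}. norm (1 - e2pi (of_nat k / of_nat n)))"
    by simp
  also have "\<dots> = real n"
    using arg_cong[OF prod_diff_nontrivial_roots_unity[OF assms], of norm] by (simp only: prod_norm norm_of_nat)
  finally show ?thesis .
qed

section \<open>Inversion of the Siegel function at a real argument\<close>

text \<open>
  The inversion formula at \<open>z = x\<close>. On the left, \<open>(1 - x) * T'\<close> arises from \<open>T' - x * T'\<close>, and the
  exponents \<open>x\<^sup>2/2\<close>, \<open>- x/2\<close> and \<open>1/12\<close> of the Gaussian factor and of the theta quotient add up to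
  \<open>B2 x / 2\<close>.
\<close>

lemma siegel_inversion:
  fixes x :: real
  assumes T: "Im T > 0" and T': "T' = - 1 / T"
  shows "e2pi (of_real (B2 x / 2) * T') *
      (qpoch (e2pi (of_real x * T')) (e2pi T') * qpoch (e2pi (of_real (1 - x) * T')) (e2pi T')) =
    of_real (2 * sin (pi * x)) * e2pi (T / 12) *
      (qpoch (e2pi (of_real x + T)) (e2pi T) * qpoch (e2pi (- of_real x + T)) (e2pi T))"
proof -
  have T0: "T \<noteq> 0" using T by auto
  have imT': "Im T' > 0" unfolding T' using T by (rule Im_inversion)
  define Q where "Q = qpoch (e2pi (of_real x * T')) (e2pi T') * qpoch (e2pi (of_real (1 - x) * T')) (e2pi T')"
  have "theta_quot (of_real x / T) (- 1 / T) = - theta_quot (of_real x * T') T'"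
    using theta_quot_minus[of "of_real x * T'" T'] by (simp add: T')
  also have "\<dots> = - \<i> * (e2pi (- (of_real x * T') / 2) * e2pi (T' / 12)) * Q"
    unfolding theta_quot_alt[OF imT'] Q_def by (simp add: ring_distribs)
  finally have "theta_quot_inv (of_real x) T =
      - \<i> * (e2pi (- (of_real x)\<^sup>2 / (2 * T)) * e2pi (- (of_real x * T') / 2) * e2pi (T' / 12)) * Q"
    unfolding theta_quot_inv_def by simp
  also have "e2pi (- (of_real x)\<^sup>2 / (2 * T)) * e2pi (- (of_real x * T') / 2) * e2pi (T' / 12) =
      e2pi (of_real (B2 x / 2) * T')"
    unfolding e2pi_add[symmetric] T'
    by (rule arg_cong[of _ _ e2pi]) (use T0 in \<open>simp add: B2_def field_simps power2_eq_square\<close>)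
  finally have "- \<i> * (e2pi (of_real (B2 x / 2) * T') * Q) = - \<i> * theta_quot (of_real x) T"
    using theta_quot_inversion[OF T, of "of_real x"] by simp
  then have "e2pi (of_real (B2 x / 2) * T') * Q = theta_quot (of_real x) T" by simp
  also have "\<dots> = (\<i> * (e2pi (- of_real x / 2) * (1 - e2pi (of_real x)))) * e2pi (T / 12) *
      (qpoch (e2pi (of_real x + T)) (e2pi T) * qpoch (e2pi (- of_real x + T)) (e2pi T))"
    by (simp add: theta_quot_def add.commute)
  also have "e2pi (- of_real x / 2) * (1 - e2pi (of_real x)) = e2pi (- of_real (x / 2)) - e2pi (of_real (x / 2))"
    by (simp add: right_diff_distrib flip: e2pi_add)
  also note e2pi_minus_diff
  also have "\<i> * (- 2 * \<i> * of_real (sin (pi * x))) = of_real (2 * sin (pi * x))"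
    by (simp add: complex_eq_iff)
  finally show ?thesis unfolding Q_def .
qed

section \<open>Sets of residues closed under negation\<close>

text \<open>
  Sets of residues, represented in \<open>{1..p-1}\<close>, that are closed under negation modulo \<open>p\<close>. Both the cubic
  cosets and the full set of nonzero residues are of this kind, so one transformation formula covers
  the single functions as well as their product.
\<close>

definition symmetric_reps :: "nat \<Rightarrow> int set \<Rightarrow> bool" where
  "symmetric_reps p D \<longleftrightarrow> D \<subseteq> {1..<int p} \<and> (\<forall>a\<in>D. int p - a \<in> D)"

lemma finite_symmetric_reps: "symmetric_reps p D \<Longrightarrow> finite D"
  unfolding symmetric_reps_def using finite_subset by blast

lemma half_reps_eq:
  assumes "D \<subseteq> {1..<int p}" shows "half_reps p D = {a \<in> D. 2 * a < int p}"
proof -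
  have "a mod int p = a" if "1 \<le> a" "2 * a < int p" for a using that by simp
  moreover have "real_of_int a < real p / 2 \<longleftrightarrow> 2 * a < int p" for a by linarith
  ultimately show ?thesis using assms unfolding half_reps_def by force
qed

lemma half_reps_reflect:
  assumes "symmetric_reps p D" "odd p"
  shows "D = half_reps p D \<union> (\<lambda>a. int p - a) ` half_reps p D"
    and "half_reps p D \<inter> (\<lambda>a. int p - a) ` half_reps p D = {}"
proof -
  have D: "D \<subseteq> {1..<int p}" "\<And>a. a \<in> D \<Longrightarrow> int p - a \<in> D"
    using assms(1) by (auto simp: symmetric_reps_def)
  have odd: "2 * a \<noteq> int p" for a using assms(2) by presburger
  have "a \<in> (\<lambda>a. int p - a) ` half_reps p D" if "a \<in> D" "\<not> 2 * a < int p" for a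
    using D that odd[of a] by (intro image_eqI[of _ _ "int p - a"]) (auto simp: half_reps_eq)
  then show "D = half_reps p D \<union> (\<lambda>a. int p - a) ` half_reps p D"
    using D by (auto simp: half_reps_eq)
  show "half_reps p D \<inter> (\<lambda>a. int p - a) ` half_reps p D = {}"
    using D by (auto simp: half_reps_eq)
qed

lemma finite_half_reps: "symmetric_reps p D \<Longrightarrow> finite (half_reps p D)"
  using finite_symmetric_reps[of p D] by (simp add: half_reps_eq symmetric_reps_def)

lemma prod_symmetric_reps:
  fixes f :: "int \<Rightarrow> 'a :: comm_monoid_mult"
  assumes "symmetric_reps p D" "odd p"
  shows "prod f D = (\<Prod>a\<in>half_reps p D. f a * f (int p - a))"
proof -
  have "prod f D = prod f (half_reps p D) * prod f ((\<lambda>a. int p - a) ` half_reps p D)"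
    using half_reps_reflect[OF assms] finite_half_reps[OF assms(1)]
    by (metis finite_imageI prod.union_disjoint)
  also have "prod f ((\<lambda>a. int p - a) ` half_reps p D) = (\<Prod>a\<in>half_reps p D. f (int p - a))"
    by (subst prod.reindex) (auto simp: inj_on_def)
  finally show ?thesis by (simp add: prod.distrib)
qed

lemma card_symmetric_reps:
  assumes "symmetric_reps p D" "odd p" shows "card D = 2 * card (half_reps p D)"
proof -
  have "card D = card (half_reps p D) + card ((\<lambda>a. int p - a) ` half_reps p D)"
    using half_reps_reflect[OF assms] finite_half_reps[OF assms(1)]
    by (metis card_Un_disjoint finite_imageI)
  then show ?thesis by (simp add: card_image inj_on_def)
qed

lemma symmetric_all_reps: "symmetric_reps p {1..<int p}"
  by (auto simp: symmetric_reps_def)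

lemma prod_all_reps: "prod f {1..<int p} = (\<Prod>k\<in>{1..<p}. f (int k))"
  by (rule prod.reindex_bij_witness[of _ int nat]) auto

text \<open>
  By the symmetry \<open>a \<mapsto> p - a\<close> the product of all \<open>2 sin (\<pi> a/p)\<close>, which is \<open>p\<close>, is the square
  of the product over the lower half.
\<close>

lemma s_prod_all:
  assumes "odd p" shows "2 ^ ((p - 1) div 2) * s_prod p {1..<int p} = sqrt (real p)"
proof -
  let ?D = "{1..<int p}" and ?s = "\<lambda>a. 2 * sin (pi * real_of_int a / real p)"
  have p: "p > 0" using assms by (rule odd_pos)
  have card: "card (half_reps p ?D) = (p - 1) div 2"
    using card_symmetric_reps[OF symmetric_all_reps assms] by simp
  have half: "2 ^ ((p - 1) div 2) * s_prod p ?D = prod ?s (half_reps p ?D)"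
    by (simp add: s_prod_def prod.distrib card)
  have refl: "?s (int p - a) = ?s a" for a
  proof -
    have "pi * real_of_int (int p - a) / real p = pi - pi * real_of_int a / real p"
      using p by (simp add: field_simps)
    then show ?thesis by (simp only: sin_pi_minus)
  qed
  have "real p = prod ?s ?D"
    using prod_two_sin[OF p] unfolding prod_all_reps by simp
  also have "\<dots> = (prod ?s (half_reps p ?D))\<^sup>2"
    unfolding prod_symmetric_reps[OF symmetric_all_reps assms] refl
    by (simp only: prod.distrib power2_eq_square)
  finally have "real p = (prod ?s (half_reps p ?D))\<^sup>2" .
  moreover have "prod ?s (half_reps p ?D) \<ge> 0"
  proof (rule prod_nonneg)
    fix a assume "a \<in> half_reps p ?D"
    then have "0 \<le> real_of_int a / real p" "real_of_int a / real p \<le> 1"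
      using p by (auto simp: half_reps_def)
    moreover from this have "0 \<le> pi * (real_of_int a / real p)" by (intro mult_nonneg_nonneg) auto
    ultimately show "?s a \<ge> 0"
      using sin_ge_zero[of "pi * (real_of_int a / real p)"] mult_left_le[of "real_of_int a / real p" pi]
      by simp
  qed
  ultimately show ?thesis unfolding half by (metis real_sqrt_unique)
qed

lemma e_exp_all:
  assumes "odd p" shows "e_exp p {1..<int p} = (1 - real p) / 24"
proof -
  obtain k where k: "p = 2 * k + 1" using assms by (elim oddE)
  have half: "half_reps p {1..<int p} = {1..int k}" using k by (auto simp: half_reps_eq)
  have "(\<Sum>a\<in>{1..int k}. B2 (real_of_int a / real p)) = (\<Sum>a=1..k. B2 (real a / real p))"
    by (rule sum.reindex_bij_witness[of _ int nat]) auto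
  then have e: "e_exp p {1..<int p} = real p / 2 * (\<Sum>a=1..k. B2 (real a / real p))"
    by (simp add: e_exp_def half)
  \<comment> \<open>The factor \<open>6 * p\<^sup>2\<close> clears the denominators; the upper limit is decoupled from \<open>p\<close> for the
    induction.\<close>
  have "6 * real p ^ 2 * (\<Sum>a=1..n. B2 (real a / real p)) =
      real n * (real n + 1) * (2 * real n + 1) - 3 * real p * (real n * (real n + 1)) + real p ^ 2 * real n" for n
  proof (induction n)
    case (Suc n)
    have "6 * P ^ 2 * B2 (x / P) = 6 * x\<^sup>2 - 6 * P * x + P ^ 2" if "P \<noteq> 0" for P x :: real
      using that by (simp add: B2_def field_simps power2_eq_square)
    from this[of "real p" "real n + 1"]
    have "6 * real p ^ 2 * B2 (real (Suc n) / real p) = 6 * (real n + 1)\<^sup>2 - 6 * real p * (real n + 1) + real p ^ 2"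
      using k by (simp add: add.commute)
    with Suc show ?case by (simp add: algebra_simps power2_eq_square)
  qed simp
  from this[of k] have sq: "6 * real p ^ 2 * (\<Sum>a=1..k. B2 (real a / real p)) = - real p * real k"
    using k by (simp add: algebra_simps power2_eq_square)
  have solve: "s = - x / (6 * P)" if "6 * P ^ 2 * s = - P * x" "P \<noteq> 0" for s x P :: real
  proof -
    have "P * (6 * P * s + x) = 0" using that(1) by (simp add: algebra_simps power2_eq_square)
    then have "6 * P * s = - x" using that(2) by simp
    then show ?thesis using that(2) by (simp add: field_simps)
  qed
  have "(\<Sum>a=1..k. B2 (real a / real p)) = - real k / (6 * real p)"
    by (rule solve[OF sq]) (use k in simp)
  then show ?thesis unfolding e using k by (simp add: field_simps)
qed

section \<open>Cosets of the cubic residues\<close>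

lemma cubic_residues_subgroup:
  assumes "prime p"
  shows "subgroup (nonzero_cubic_residues p) (units_of (residue_ring (int p)))"
    and "carrier (units_of (residue_ring (int p))) = {1..<int p}"
    and "group (units_of (residue_ring (int p)))"
proof -
  interpret residues_prime p "residue_ring (int p)" using assms by unfold_locales auto
  let ?G = "units_of (residue_ring (int p))" and ?H = "nonzero_cubic_residues p"
  have p: "p > 1" using assms by (rule prime_gt_1_nat)
  show carr: "carrier ?G = {1..<int p}"
    using p by (auto simp: units_of_carrier res_prime_units_eq)
  show "group ?G" by (rule units_group)
  then interpret G: group ?G .
  have mult: "x \<otimes>\<^bsub>?G\<^esub> y = (x * y) mod int p" for x y
    by (simp add: units_of_mult res_mult_eq)
  have one: "\<one>\<^bsub>?G\<^esub> = 1" by (simp add: units_of_one res_one_eq)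
  show "subgroup ?H ?G"
  proof (rule G.subgroupI)
    show sub: "?H \<subseteq> carrier ?G" unfolding carr by (auto simp: nonzero_cubic_residues_def)
    have "[1 ^ 3 = 1] (mod int p)" by simp
    then show "?H \<noteq> {}" using p by (auto simp: nonzero_cubic_residues_def intro!: exI[of _ 1])
    show "inv\<^bsub>?G\<^esub> x \<in> ?H" if x: "x \<in> ?H" for x
    proof -
      define z where "z = inv\<^bsub>?G\<^esub> x"
      have z: "z \<in> carrier ?G" and "x \<otimes>\<^bsub>?G\<^esub> z = \<one>\<^bsub>?G\<^esub>"
        using x sub by (auto simp: z_def)
      then have xz: "[x * z = 1] (mod int p)" using p by (simp add: mult one cong_def)
      obtain y where y: "[y ^ 3 = x] (mod int p)" using x by (auto simp: nonzero_cubic_residues_def)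
      \<comment> \<open>If \<open>x\<close> is the cube of \<open>y\<close> and \<open>z\<close> is inverse to \<open>x\<close>, then \<open>z = x\<^sup>2 * z ^ 3\<close> is the cube
        of \<open>y\<^sup>2 * z\<close>.\<close>
      have "(y\<^sup>2 * z) ^ 3 = (y ^ 3)\<^sup>2 * z ^ 3" by (simp add: power2_eq_square power3_eq_cube)
      also have "[\<dots> = x\<^sup>2 * z ^ 3] (mod int p)" by (intro cong_mult cong_pow y cong_refl)
      also have "x\<^sup>2 * z ^ 3 = (x * z)\<^sup>2 * z" by (simp add: power2_eq_square power3_eq_cube)
      also have "[\<dots> = 1\<^sup>2 * z] (mod int p)" by (intro cong_mult cong_pow xz cong_refl)
      finally show ?thesis using z unfolding z_def[symmetric] carr
        by (auto simp: nonzero_cubic_residues_def)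
    qed
    show "x \<otimes>\<^bsub>?G\<^esub> y \<in> ?H" if xy: "x \<in> ?H" "y \<in> ?H" for x y
    proof -
      obtain u v where "[u ^ 3 = x] (mod int p)" "[v ^ 3 = y] (mod int p)"
        using xy by (auto simp: nonzero_cubic_residues_def)
      then have "[(u * v) ^ 3 = (x * y) mod int p] (mod int p)"
        by (simp add: power_mult_distrib cong_mult cong_mod_right)
      moreover have "x \<otimes>\<^bsub>?G\<^esub> y \<in> carrier ?G" using xy sub by blast
      ultimately show ?thesis unfolding carr mult by (auto simp: nonzero_cubic_residues_def)
    qed
  qed
qed

text \<open>
  A coset is stable under multiplication by the subgroup, and \<open>-1\<close> is the cube of \<open>-1\<close>.
\<close>

lemma cubic_coset_symmetric:
  assumes "prime p" "D \<in> cubic_cosets p"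
  shows "symmetric_reps p D"
  unfolding symmetric_reps_def
proof (intro conjI ballI)
  let ?G = "units_of (residue_ring (int p))" and ?H = "nonzero_cubic_residues p"
  interpret residues_prime p "residue_ring (int p)" using assms(1) by unfold_locales auto
  interpret G: group ?G by (rule cubic_residues_subgroup(3)[OF assms(1)])
  note H = cubic_residues_subgroup(1)[OF assms(1)]
  note carr = cubic_residues_subgroup(2)[OF assms(1)]
  have mult: "x \<otimes>\<^bsub>?G\<^esub> y = (x * y) mod int p" for x y
    by (simp add: units_of_mult res_mult_eq)
  show sub: "D \<subseteq> {1..<int p}"
    using subgroup.rcosets_carrier[OF H G.is_group] assms(2) unfolding carr cubic_cosets_def by blast
  fix a assume a: "a \<in> D"
  obtain g where g: "D = ?H #>\<^bsub>?G\<^esub> g"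
    using assms(2) by (auto simp: cubic_cosets_def RCOSETS_def)
  then obtain h where h: "h \<in> ?H" "a = (h * g) mod int p" using a by (auto simp: r_coset_def mult)
  then obtain y where y: "[y ^ 3 = h] (mod int p)" and hp: "1 \<le> h" "h < int p"
    by (auto simp: nonzero_cubic_residues_def)
  have "(- y) ^ 3 = - (y ^ 3)" by simp
  also have "[\<dots> = - h] (mod int p)" using y by (simp add: cong_minus_minus_iff)
  also have "[- h = int p - h] (mod int p)" by (simp add: cong_iff_dvd_diff)
  finally have "\<exists>w. [w ^ 3 = int p - h] (mod int p)" by blast
  then have "int p - h \<in> ?H" using hp by (auto simp: nonzero_cubic_residues_def)
  then have "((int p - h) * g) mod int p \<in> D" unfolding g by (auto simp: r_coset_def mult)
  moreover have "((int p - h) * g) mod int p = int p - a"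
  proof -
    have "[(int p - h) * g = int p - a] (mod int p)"
      unfolding h(2) cong_def
      by (metis (no_types, opaque_lifting) left_diff_distrib mod_diff_left_eq
          mod_diff_right_eq mod_mult_self1_is_0 mod_self mult.commute)
    moreover have "0 \<le> int p - a" "int p - a < int p" using a sub by auto
    ultimately show ?thesis unfolding cong_def using mod_pos_pos_trivial by metis
  qed
  ultimately show "int p - a \<in> D" by simp
qed

lemma cubic_cosets_partition:
  assumes "prime p"
  shows "\<Union> (cubic_cosets p) = {1..<int p}" "disjoint (cubic_cosets p)"
    and "D \<in> cubic_cosets p \<Longrightarrow> card (cubic_cosets p) * card D = p - 1"
proof -
  let ?G = "units_of (residue_ring (int p))" and ?H = "nonzero_cubic_residues p"
  interpret G: group ?G by (rule cubic_residues_subgroup(3)[OF assms(1)])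
  note H = cubic_residues_subgroup(1)[OF assms(1)]
  note carr = cubic_residues_subgroup(2)[OF assms(1)]
  show "\<Union> (cubic_cosets p) = {1..<int p}"
    using G.rcosets_part_G[OF H] by (simp add: carr cubic_cosets_def)
  show "disjoint (cubic_cosets p)"
    using G.rcos_disjoint[OF H] by (simp add: cubic_cosets_def)
  show "card (cubic_cosets p) * card D = p - 1" if D: "D \<in> cubic_cosets p"
  proof -
    have "card (cubic_cosets p) * card ?H = p - 1"
      using G.lagrange[OF H] by (simp add: cubic_cosets_def order_def carr)
    moreover obtain f where "bij_betw f ?H D"
      using G.card_cosets_equal[of D ?H] D subgroup.subset[OF H] by (auto simp: cubic_cosets_def)
    ultimately show ?thesis using bij_betw_same_card by fastforce
  qed
qed

section \<open>Generalized eta quotients over a set of residues\<close>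

lemma convergent_select:
  fixes q :: complex
  assumes "norm q < 1" shows "convergent_prod (\<lambda>n. if P n then 1 - q ^ Suc n else 1)"
proof (rule abs_convergent_prod_imp_convergent_prod)
  have "summable (\<lambda>n. norm ((if P n then 1 - q ^ Suc n else 1) - 1))"
  proof (rule summable_comparison_test')
    show "summable (\<lambda>n. norm q ^ Suc n)" using assms by (simp add: summable_geometric)
    show "norm (norm ((if P n then 1 - q ^ Suc n else 1) - 1)) \<le> norm q ^ Suc n" for n
      by (simp add: norm_mult norm_power)
  qed
  then show "abs_convergent_prod (\<lambda>n. if P n then 1 - q ^ Suc n else 1)"
    by (simp add: abs_convergent_prod_conv_summable)
qed

text \<open>
  Splitting the product by residue classes modulo \<open>p\<close> leaves one q-Pochhammer product with
  base \<open>q ^ p\<close> for each class in \<open>D\<close>.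
\<close>

lemma prodinf_select_classes:
  assumes q: "norm q < 1" and p: "p > 0" and D: "D \<subseteq> {1..<int p}"
  shows "(\<Prod>n. if int (Suc n) mod int p \<in> D then 1 - q ^ Suc n else 1) =
    (\<Prod>a\<in>D. qpoch (q ^ nat a) (q ^ p))"
proof -
  let ?g = "\<lambda>n. if int (Suc n) mod int p \<in> D then 1 - q ^ Suc n else 1"
  have qk: "norm (q ^ p) < 1" using assms by (simp add: norm_power power_less_one_iff)
  have g: "?g (p * n + r) = (if int (Suc r) \<in> D then 1 - q ^ Suc r * (q ^ p) ^ n else 1)" if "r < p" for n r
  proof -
    have "int (Suc (p * n + r)) = int (Suc r) + int p * int n" by simp
    then have "int (Suc (p * n + r)) mod int p = int (Suc r) mod int p"
      by (simp only: mod_mult_self2)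
    moreover have "int (Suc r) mod int p \<in> D \<longleftrightarrow> int (Suc r) \<in> D"
    \<comment> \<open>The last class in this indexing is that of \<open>0\<close>, represented by \<open>p\<close>, which lies outside
      \<open>{1..p-1}\<close> on both sides.\<close>
    proof (cases "Suc r = p")
      case True
      then show ?thesis using D by auto
    next
      case False
      then have "int (Suc r) mod int p = int (Suc r)" using that by (intro mod_pos_pos_trivial) auto
      then show ?thesis by simp
    qed
    moreover have "Suc (p * n + r) = Suc r + p * n" by simp
    then have "q ^ Suc (p * n + r) = q ^ Suc r * (q ^ p) ^ n" by (simp only: power_add power_mult)
    ultimately show ?thesis by (simp only:)
  qed
  have idx: "int (Suc (nat (a - 1))) = a" "nat (a - 1) < p" if "a \<in> D" for a
  proof -
    have "1 \<le> a" "a < int p" using D that by auto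
    then show "int (Suc (nat (a - 1))) = a" "nat (a - 1) < p" by linarith+
  qed
  have "prodinf ?g = (\<Prod>r<p. \<Prod>n. ?g (p * n + r))"
  proof (rule prodinf_residue_classes[OF p convergent_select[OF q]])
    show "convergent_prod (\<lambda>n. ?g (p * n + r))" if "r < p" for r
      by (cases "int (Suc r) \<in> D")
         (simp_all only: g[OF that] if_True if_False convergent_qpoch[OF qk] convergent_prod_one)
  qed
  also have "\<dots> = (\<Prod>r<p. if int (Suc r) \<in> D then qpoch (q ^ Suc r) (q ^ p) else 1)"
    by (intro prod.cong refl) (simp only: g lessThan_iff qpoch_def, simp)
  also have "\<dots> = (\<Prod>r\<in>{r\<in>{..<p}. int (Suc r) \<in> D}. qpoch (q ^ Suc r) (q ^ p))"
    by (simp only: prod.inter_filter finite_lessThan)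
  also have "\<dots> = (\<Prod>a\<in>D. qpoch (q ^ nat a) (q ^ p))"
    by (intro prod.reindex_bij_witness[of _ "\<lambda>a. nat (a - 1)" "\<lambda>r. int (Suc r)"])
       (auto simp: idx simp del: of_nat_Suc power_Suc)
  finally show ?thesis .
qed

lemma G_eq:
  assumes \<tau>: "Im \<tau> > 0" and p: "p > 0" and D: "D \<subseteq> {1..<int p}"
  shows "G p D \<tau> = inverse (e2pi (of_real (e_exp p D) * \<tau>) *
    (\<Prod>a\<in>D. qpoch (e2pi (of_int a * \<tau>)) (e2pi (of_nat p * \<tau>))))"
proof -
  let ?g = "\<lambda>n. if int (Suc n) mod int p \<in> D then 1 - e2pi \<tau> ^ Suc n else 1"
  have "(\<Prod>n. if int (Suc n) mod int p \<in> D then inverse (1 - nome \<tau> ^ Suc n) else 1) =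
      (\<Prod>n. inverse (?g n))"
    by (intro prodinf_cong) (simp add: e2pi_def)
  also have "\<dots> = inverse (prodinf ?g)" using \<tau> by (intro prodinf_inverse convergent_select) simp
  also have "prodinf ?g = (\<Prod>a\<in>D. qpoch (e2pi \<tau> ^ nat a) (e2pi \<tau> ^ p))"
    using \<tau> p D by (intro prodinf_select_classes) auto
  also have "\<dots> = (\<Prod>a\<in>D. qpoch (e2pi (of_int a * \<tau>)) (e2pi (of_nat p * \<tau>)))"
  proof (intro prod.cong refl)
    fix a assume "a \<in> D"
    then have "of_int a = (of_nat (nat a) :: complex)" using D by auto
    then show "qpoch (e2pi \<tau> ^ nat a) (e2pi \<tau> ^ p) = qpoch (e2pi (of_int a * \<tau>)) (e2pi (of_nat p * \<tau>))"
      by (simp only: e2pi_of_nat_mult)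
  qed
  finally show ?thesis by (simp add: G_def qpow_eq e2pi_minus)
qed

lemma T_prod_eq:
  assumes "Im \<tau> > 0"
  shows "T_prod p D \<tau> = (\<Prod>a\<in>D. qpoch (e2pi (of_int a / of_nat p + \<tau>)) (e2pi \<tau>))"
proof -
  have "T_prod p D \<tau> = (\<Prod>n. \<Prod>a\<in>D. 1 - e2pi (of_int a / of_nat p + \<tau>) * e2pi \<tau> ^ n)"
    unfolding T_prod_def zeta_powi_eq e2pi_def[symmetric] by (simp add: e2pi_add mult.assoc)
  then show ?thesis unfolding qpoch_def using assms by (simp add: prodinf_prod convergent_qpoch)
qed

lemma dedekind_eta_eq: "dedekind_eta \<tau> = e2pi (\<tau> / 24) * qpoch (e2pi \<tau>) (e2pi \<tau>)"
  by (simp add: dedekind_eta_def qpow_eq qpoch_def e2pi_def)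

lemma e_exp_union:
  assumes "D \<subseteq> {1..<int p}" "E \<subseteq> {1..<int p}" "D \<inter> E = {}"
  shows "e_exp p (D \<union> E) = e_exp p D + e_exp p E"
proof -
  have "half_reps p (D \<union> E) = half_reps p D \<union> half_reps p E" "half_reps p D \<inter> half_reps p E = {}"
    using assms by (auto simp: half_reps_def)
  moreover have "finite (half_reps p D)" "finite (half_reps p E)"
    using assms finite_subset[OF assms(1)] finite_subset[OF assms(2)] by (auto simp: half_reps_eq)
  ultimately show ?thesis by (simp add: e_exp_def sum.union_disjoint ring_distribs)
qed

lemma G_union:
  assumes "Im \<tau> > 0" "p > 0" "D \<subseteq> {1..<int p}" "E \<subseteq> {1..<int p}" "D \<inter> E = {}"
  shows "G p (D \<union> E) \<tau> = G p D \<tau> * G p E \<tau>"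
proof -
  have "finite D" "finite E" using assms finite_subset by blast+
  then show ?thesis
    using assms by (simp add: G_eq e_exp_union prod.union_disjoint ring_distribs e2pi_add)
qed

text \<open>
  For \<open>\<tau>' = -1/(p\<tau>)\<close> the base \<open>q'^p\<close> of the products in \<open>G\<close> belongs to \<open>p\<tau>' = -1/\<tau>\<close>. So each pair
  \<open>a\<close>, \<open>p - a\<close> contributes one Siegel inversion, with \<open>x = a/p\<close> and \<open>T = \<tau>\<close>; the definition of \<open>e_exp\<close> collects
  precisely the exponentials with \<open>B2\<close>.
\<close>

theorem G_inversion:
  assumes D: "symmetric_reps p D" and p: "odd p" and \<tau>: "Im \<tau> > 0" and k: "k = card (half_reps p D)"
  shows "G p D (- 1 / (of_nat p * \<tau>)) =
    qpow \<tau> (- real k / 12) / (2 ^ k * of_real (s_prod p D) * T_prod p D \<tau>)"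
proof -
  define \<tau>' where "\<tau>' = - 1 / (of_nat p * \<tau>)"
  have p0: "p > 0" using p by (rule odd_pos)
  have Dsub: "D \<subseteq> {1..<int p}" using D by (simp add: symmetric_reps_def)
  have "Im (of_nat p * \<tau>) > 0" using p0 \<tau> by simp
  then have \<tau>': "Im \<tau>' > 0" unfolding \<tau>'_def by (rule Im_inversion)
  have T': "of_nat p * \<tau>' = - 1 / \<tau>" using p0 by (simp add: \<tau>'_def)
  let ?x = "\<lambda>a. real_of_int a / real p"
  let ?Pq = "\<lambda>a. qpoch (e2pi (of_int a * \<tau>')) (e2pi (of_nat p * \<tau>'))"
  let ?t = "\<lambda>a. qpoch (e2pi (of_int a / of_nat p + \<tau>)) (e2pi \<tau>)"
  have e: "e2pi (of_real (e_exp p D) * \<tau>') =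
      (\<Prod>a\<in>half_reps p D. e2pi (of_real (B2 (?x a) / 2) * (of_nat p * \<tau>')))"
    unfolding e2pi_sum[symmetric]
    by (simp add: e_exp_def sum_distrib_right sum_divide_distrib[symmetric] mult_ac flip: sum_distrib_left)
  have each: "e2pi (of_real (B2 (?x a) / 2) * (of_nat p * \<tau>')) * (?Pq a * ?Pq (int p - a)) =
      of_real (2 * sin (pi * ?x a)) * e2pi (\<tau> / 12) * (?t a * ?t (int p - a))" for a
  proof -
    have 1: "of_real (?x a) * (of_nat p * \<tau>') = of_int a * \<tau>'"
      and 2: "of_real (1 - ?x a) * (of_nat p * \<tau>') = of_int (int p - a) * \<tau>'"
      and 3: "of_real (?x a) + \<tau> = of_int a / of_nat p + \<tau>"
      using p0 by (simp_all add: field_simps)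
    have "of_int (int p - a) / of_nat p + \<tau> = of_int 1 + (- of_real (?x a) + \<tau>)"
      using p0 by (simp add: diff_divide_distrib)
    then have 4: "e2pi (of_int (int p - a) / of_nat p + \<tau>) = e2pi (- of_real (?x a) + \<tau>)"
      by (simp only: e2pi_of_int_add)
    show ?thesis
      using siegel_inversion[OF \<tau> T', of "?x a"] unfolding 1 2 3 4 .
  qed
  have "e2pi (of_real (e_exp p D) * \<tau>') * prod ?Pq D =
      (\<Prod>a\<in>half_reps p D. of_real (2 * sin (pi * ?x a)) * e2pi (\<tau> / 12) * (?t a * ?t (int p - a)))"
    unfolding e prod_symmetric_reps[OF D p, of ?Pq] each[symmetric] by (simp only: prod.distrib)
  also have "\<dots> = 2 ^ k * of_real (s_prod p D) * e2pi (\<tau> / 12) ^ k * T_prod p D \<tau>"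
    unfolding T_prod_eq[OF \<tau>] prod_symmetric_reps[OF D p, of ?t] s_prod_def k
    by (simp add: prod.distrib)
  also have "e2pi (\<tau> / 12) ^ k = inverse (qpow \<tau> (- real k / 12))"
    using e2pi_of_nat_mult[of k "\<tau> / 12"] by (simp add: qpow_eq e2pi_minus)
  finally show ?thesis
    unfolding G_eq[OF \<tau>' p0 Dsub, unfolded \<tau>'_def] \<tau>'_def by (simp add: field_simps)
qed

text \<open>
  For each \<open>n\<close> the factor \<open>1 - q^n\<close> supplies the trivial root of unity, and the product over all
  \<open>p\<close>-th roots of unity is \<open>1 - q^(pn)\<close>.
\<close>

lemma T_prod_all:
  assumes "p > 0" "Im \<tau> > 0"
  shows "T_prod p {1..<int p} \<tau> * qpoch (e2pi \<tau>) (e2pi \<tau>) =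
    qpoch (e2pi (of_nat p * \<tau>)) (e2pi (of_nat p * \<tau>))"
proof -
  let ?t = "\<lambda>k::nat. qpoch (e2pi (of_nat k / of_nat p) * e2pi \<tau>) (e2pi \<tau>)"
  have q: "norm (e2pi \<tau>) < 1" using assms by simp
  have "T_prod p {1..<int p} \<tau> = prod ?t {1..<p}"
    unfolding T_prod_eq[OF assms(2)] prod_all_reps by (simp add: e2pi_add)
  moreover have "{..<p} = insert 0 {1..<p}" using assms by auto
  ultimately have "T_prod p {1..<int p} \<tau> * qpoch (e2pi \<tau>) (e2pi \<tau>) = prod ?t {..<p}" by simp
  also have "\<dots> = (\<Prod>n. \<Prod>k<p. 1 - e2pi (of_nat k / of_nat p) * e2pi \<tau> * e2pi \<tau> ^ n)"
    unfolding qpoch_def by (intro prodinf_prod[symmetric] convergent_qpoch q)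
  also have "\<dots> = qpoch (e2pi \<tau> ^ p) (e2pi \<tau> ^ p)"
    unfolding qpoch_def
  proof (intro prodinf_cong)
    fix n
    show "(\<Prod>k<p. 1 - e2pi (of_nat k / of_nat p) * e2pi \<tau> * e2pi \<tau> ^ n) = 1 - e2pi \<tau> ^ p * (e2pi \<tau> ^ p) ^ n"
      using prod_diff_roots_unity[OF assms(1), of "e2pi \<tau> * e2pi \<tau> ^ n"]
      by (simp only: mult.assoc power_mult_distrib power_commutes flip: power_mult) (simp add: mult.commute)
  qed
  finally show ?thesis by (simp only: e2pi_of_nat_mult)
qed

text \<open>
  Restricting the Euler product of \<open>\<tau>\<close> to the indices divisible by \<open>p\<close> gives the one of \<open>p\<tau>\<close>; what
  remains are the indices entering \<open>G\<close>.
\<close>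

lemma G_all_eta:
  assumes p: "odd p" and \<tau>: "Im \<tau> > 0"
  shows "G p {1..<int p} \<tau> = dedekind_eta (of_nat p * \<tau>) / dedekind_eta \<tau>"
proof -
  let ?q = "e2pi \<tau>" and ?Q = "e2pi (of_nat p * \<tau>)"
  have p0: "p > 0" using p by (rule odd_pos)
  have q: "norm ?q < 1" and Q: "norm ?Q < 1" using \<tau> p0 by simp_all
  let ?P = "\<Prod>a\<in>{1..<int p}. qpoch (e2pi (of_int a * \<tau>)) ?Q"
  have "qpoch ?q ?q = (\<Prod>r<p. qpoch (?q * ?q ^ r) (?q ^ p))" by (rule qpoch_dissect[OF q p0])
  also have "\<dots> = (\<Prod>k\<in>{1..p}. qpoch (e2pi (of_nat k * \<tau>)) ?Q)"
    by (rule prod.reindex_bij_witness[of _ "\<lambda>k. k - 1" Suc])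
       (auto simp: e2pi_of_nat_mult simp del: of_nat_Suc simp flip: power_Suc)
  also have "{1..p} = insert p {1..<p}" using p0 by auto
  finally have qpoch: "qpoch ?q ?q = qpoch ?Q ?Q * ?P" unfolding prod_all_reps by simp
  have nz: "qpoch ?q ?q \<noteq> 0" "qpoch ?Q ?Q \<noteq> 0" using qpoch_nonzero_norm q Q by blast+
  have "e2pi (of_real ((1 - real p) / 24) * \<tau>) = e2pi (\<tau> / 24) / e2pi (of_nat p * \<tau> / 24)"
    unfolding e2pi_diff[symmetric] by (rule arg_cong[of _ _ e2pi]) (simp add: field_simps)
  then show ?thesis
    unfolding G_eq[OF \<tau> p0 order_refl] e_exp_all[OF p] dedekind_eta_eq qpoch using nz qpoch
    by (simp add: field_simps)
qed

lemma G_all_inversion: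
  assumes p: "odd p" and \<tau>: "Im \<tau> > 0"
  shows "G p {1..<int p} (- 1 / (of_nat p * \<tau>)) = 1 / (of_real (sqrt (real p)) * G p {1..<int p} \<tau>)"
proof -
  let ?D = "{1..<int p}" and ?k = "(p - 1) div 2"
  have p0: "p > 0" using p by (rule odd_pos)
  have k: "?k = card (half_reps p ?D)"
    using card_symmetric_reps[OF symmetric_all_reps p] by simp
  have "qpoch (e2pi \<tau>) (e2pi \<tau>) \<noteq> 0" using \<tau> by (intro qpoch_nonzero_norm) auto
  then have "G p ?D \<tau> = e2pi (of_nat p * \<tau> / 24) / e2pi (\<tau> / 24) * T_prod p ?D \<tau>"
    unfolding G_all_eta[OF p \<tau>] dedekind_eta_eq T_prod_all[OF p0 \<tau>, symmetric] by simp
  moreover have "qpow \<tau> (- real ?k / 12) = e2pi (\<tau> / 24) / e2pi (of_nat p * \<tau> / 24)"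
  proof -
    obtain l where l: "p = 2 * l + 1" using p by (elim oddE)
    show ?thesis unfolding qpow_eq e2pi_diff[symmetric]
      by (rule arg_cong[of _ _ e2pi]) (simp add: l field_simps)
  qed
  moreover have "2 ^ ?k * of_real (s_prod p ?D) = complex_of_real (sqrt (real p))"
    unfolding s_prod_all[OF p, symmetric] by simp
  ultimately show ?thesis
    unfolding G_inversion[OF symmetric_all_reps p \<tau> k] by simp
qed

section \<open>The three cubic cosets\<close>

theorem proposition7p1:
  fixes p m :: nat and C :: "nat \<Rightarrow> int set" and \<tau> :: complex
  assumes "prime p" and "[p = 1] (mod 3)"
    and "m = (p - 1) div 6"
    and "bij_betw C {..<3} (cubic_cosets p)"
    and "Im \<tau> > 0"
  shows "(\<Sum>j<3. e_exp p (C j)) = (1 - real p) / 24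
    \<and> G p (C 0) \<tau> * G p (C 1) \<tau> * G p (C 2) \<tau>
        = dedekind_eta (of_nat p * \<tau>) / dedekind_eta \<tau>
    \<and> (\<forall>j<3. G p (C j) (- 1 / (of_nat p * \<tau>))
        = qpow \<tau> (- real m / 12) / (2 ^ m * of_real (s_prod p (C j)) * T_prod p (C j) \<tau>))
    \<and> (let \<tau>' = - 1 / (of_nat p * \<tau>) in
        G p (C 0) \<tau>' * G p (C 1) \<tau>' * G p (C 2) \<tau>'
        = 1 / (of_real (sqrt (real p)) * (G p (C 0) \<tau> * G p (C 1) \<tau> * G p (C 2) \<tau>)))"
proof -
  have "p \<noteq> 2" using assms(2) by (auto simp: cong_def)
  then have p: "odd p" using assms(1) prime_ge_2_nat[of p] prime_odd_nat[of p] by simp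
  have p0: "p > 0" using p by (rule odd_pos)
  have three: "{..<3} = {0, 1, 2::nat}" by auto
  have C: "C j \<in> cubic_cosets p" if "j < 3" for j
    using assms(4) that by (auto simp: bij_betw_def)
  have sym: "symmetric_reps p (C j)" if "j < 3" for j
    using cubic_coset_symmetric[OF assms(1) C[OF that]] .
  have sub: "C j \<subseteq> {1..<int p}" if "j < 3" for j
    using sym[OF that] by (simp add: symmetric_reps_def)
  have disj: "C i \<inter> C j = {}" if "i < 3" "j < 3" "i \<noteq> j" for i j
  proof -
    have "C i \<noteq> C j" using assms(4) that by (auto simp: bij_betw_def inj_on_def)
    then show ?thesis
      using cubic_cosets_partition(2)[OF assms(1)] C that by (auto simp: disjoint_def)
  qed
  have "\<Union> (C ` {..<3}) = {1..<int p}"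
    using cubic_cosets_partition(1)[OF assms(1)] assms(4) by (simp add: bij_betw_def)
  then have union: "{1..<int p} = (C 0 \<union> C 1) \<union> C 2" unfolding three by auto
  have d: "C 0 \<inter> C 1 = {}" "(C 0 \<union> C 1) \<inter> C 2 = {}"
    using disj[of 0 1] disj[of 0 2] disj[of 1 2] by auto
  have s: "C 0 \<subseteq> {1..<int p}" "C 1 \<subseteq> {1..<int p}" "C 2 \<subseteq> {1..<int p}"
      "C 0 \<union> C 1 \<subseteq> {1..<int p}"
    using sub[of 0] sub[of 1] sub[of 2] by auto
  have G3: "G p (C 0) t * G p (C 1) t * G p (C 2) t = G p {1..<int p} t" if "Im t > 0" for t
    using G_union[OF that p0 s(1,2) d(1)] G_union[OF that p0 s(4,3) d(2)] unfolding union by simp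
  have m: "m = card (half_reps p (C j))" if "j < 3" for j
  proof -
    have "card (cubic_cosets p) = 3" using bij_betw_same_card[OF assms(4)] by simp
    then have "3 * card (C j) = p - 1" using cubic_cosets_partition(3)[OF assms(1) C[OF that]] by simp
    then show ?thesis using card_symmetric_reps[OF sym[OF that] p] assms(3) by simp
  qed
  have e3: "(\<Sum>j<3. e_exp p (C j)) = e_exp p {1..<int p}"
    unfolding three union using e_exp_union[OF s(1,2) d(1)] e_exp_union[OF s(4,3) d(2)] by simp
  have "Im (of_nat p * \<tau>) > 0" using p0 assms(5) by simp
  then have \<tau>': "Im (- 1 / (of_nat p * \<tau>)) > 0" by (rule Im_inversion)
  show ?thesis
    unfolding Let_def G3[OF \<tau>'] G3[OF assms(5)] e3
    using e_exp_all[OF p] G_all_eta[OF p assms(5)] G_all_inversion[OF p assms(5)]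
      G_inversion[OF sym p assms(5) m] by blast
qed

end
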